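(* Let $d\ge3$ and $K\ge1$, and let $G$ be a $d$-regular graph of even diameter $D=2K$ that is diameter-maximal. Then $G$ consists of two vertex-disjoint Bethe trees of degree $d$ with $K$ levels, plus a center consisting of at least $2(d-1)^{K-1}$ vertices that are not part of either tree. The total number of vertices $n$ of $G$ satisfies $$n\ge 2\left(1+d\sum_{j=0}^{K-2}(d-1)^j\right)+2(d-1)^{K-1}=4\left(\frac{(d-1)^K-1}{d-2}\right).$$
   Context: Graphs are finite, simple and connected. The algebraic connectivity $AC(G)$ is the second smallest eigenvalue (with multiplicity) of the Laplacian matrix of $G$. A $d$-regular graph $G$ of even diameter $D=2K$ is called diameter-maximal if $AC(G)=d-2\sqrt{d-1}\cos\theta$, where $\theta$ is the smallest positive root of $$\tan(\theta K)=-\frac{d}{d-2}\tan\theta$$ (the quantity $d-2\sqrt{d-1}\cos\theta$ is an upper bound for the algebraic connectivity of every $d$-regular graph of diameter $2K$). The Bethe tree $T_{K,d}$ of degree $d$ with $K$ levels is the rooted tree whose levels are the vertices at distance $0,1,\dots,K-1$ from the root, in which every non-leaf vertex has degree $d$ and all leaves are at distance $K-1$ from the root (for $K=1$ it is a single vertex). "$G$ consists of two Bethe trees plus a center" means that $G$ has two vertex-disjoint subgraphs isomorphic to $T_{K,d}$, and the center is the set of all remaining vertices of $G$. *)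

theory Defs
  imports
    "Graph_Theory.Graph_Theory"
    "Jordan_Normal_Form.Char_Poly"
begin

text \<open>
  A finite simple graph is a \<^term>\<open>G :: 'a pair_pre_digraph\<close> with \<^prop>\<open>pair_graph G\<close>: finite,
  loopfree and symmetric, each undirected edge being represented by its two orientations.  The
  degree of a vertex is therefore its out-degree, and arc walks have the length of the
  corresponding undirected walks.
\<close>

definition regular_graph :: "nat \<Rightarrow> 'a pair_pre_digraph \<Rightarrow> bool" where
  "regular_graph d G \<longleftrightarrow> (\<forall>v \<in> pverts G. out_degree (with_proj G) v = d)"

definition graph_dist :: "'a pair_pre_digraph \<Rightarrow> 'a \<Rightarrow> 'a \<Rightarrow> ereal" where
  "graph_dist G = wf_digraph.\<mu> (with_proj G) (\<lambda>_. 1)"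

definition graph_diameter :: "'a pair_pre_digraph \<Rightarrow> ereal" where
  "graph_diameter G = (SUP u \<in> pverts G. SUP v \<in> pverts G. graph_dist G u v)"

definition laplacian_mat :: "'a pair_pre_digraph \<Rightarrow> 'a list \<Rightarrow> real mat" where
  "laplacian_mat G vs = mat (length vs) (length vs) (\<lambda>(i, j).
     if i = j then real (out_degree (with_proj G) (vs ! i))
     else if (vs ! i, vs ! j) \<in> parcs G then -1 else 0)"

text \<open>
  The Laplacian eigenvalues with multiplicity are the roots of the characteristic polynomial; all
  of them are real because the matrix is symmetric.  The choice of the enumeration of the vertices
  is immaterial, since another one conjugates the matrix by a permutation matrix.  Counting from 0,
  the second smallest eigenvalue has index 1.
\<close>

definition laplacian_spectrum :: "'a pair_pre_digraph \<Rightarrow> real multiset" where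
  "laplacian_spectrum G =
     proots (char_poly (laplacian_mat G (SOME vs. distinct vs \<and> set vs = pverts G)))"

definition algebraic_connectivity :: "'a pair_pre_digraph \<Rightarrow> real" where
  "algebraic_connectivity G = sorted_list_of_multiset (laplacian_spectrum G) ! 1"

definition tan_root :: "nat \<Rightarrow> nat \<Rightarrow> real \<Rightarrow> bool" where
  "tan_root d K \<theta> \<longleftrightarrow> tan (\<theta> * real K) = - (real d / (real d - 2)) * tan \<theta>"

definition smallest_pos_tan_root :: "nat \<Rightarrow> nat \<Rightarrow> real \<Rightarrow> bool" where
  "smallest_pos_tan_root d K \<theta> \<longleftrightarrow>
     0 < \<theta> \<and> tan_root d K \<theta> \<and> (\<forall>\<phi>. 0 < \<phi> \<and> tan_root d K \<phi> \<longrightarrow> \<theta> \<le> \<phi>)"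

text \<open>
  For \<open>K \<ge> 2\<close> and \<open>d \<ge> 3\<close> the smallest positive root lies strictly between \<open>pi / (2 * K)\<close> and
  \<open>pi / K\<close>, and the convention \<^prop>\<open>tan (pi / 2) = (0 :: real)\<close> adds no smaller one.  For \<open>K = 1\<close>
  the two sides have a common pole at \<open>pi / 2\<close>, which the convention makes a root, in agreement
  with the form \<open>(d - 2) * sin (K * \<theta>) * cos \<theta> = - d * cos (K * \<theta>) * sin \<theta>\<close> of the equation; the
  bound on the algebraic connectivity is then \<open>d\<close>.  (Excluding the pole would give \<open>\<theta> = pi\<close> and
  the value \<open>d + 2 * sqrt (d - 1)\<close>, which no graph of diameter 2 attains.)
\<close>

definition diameter_maximal :: "nat \<Rightarrow> nat \<Rightarrow> 'a pair_pre_digraph \<Rightarrow> bool" where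
  "diameter_maximal d K G \<longleftrightarrow> (\<exists>\<theta>. smallest_pos_tan_root d K \<theta> \<and>
     algebraic_connectivity G = real d - 2 * sqrt (real d - 1) * cos \<theta>)"

text \<open>
  A vertex of the Bethe tree is the list of child indices on the path from the root \<open>[]\<close> to it, so
  its length is its distance from the root.  The root has \<open>d\<close> children and every other
  non-leaf has \<open>d - 1\<close> children besides its parent.
\<close>

definition bethe_verts :: "nat \<Rightarrow> nat \<Rightarrow> nat list set" where
  "bethe_verts d K =
     {xs. length xs < K \<and> (\<forall>i < length xs. xs ! i < (if i = 0 then d else d - 1))}"

definition bethe_tree :: "nat \<Rightarrow> nat \<Rightarrow> nat list pair_pre_digraph" where
  "bethe_tree d K = \<lparr> pverts = bethe_verts d K,
     parcs = {(xs, ys). xs \<in> bethe_verts d K \<and> ys \<in> bethe_verts d K \<and>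
                        (\<exists>i. ys = xs @ [i] \<or> xs = ys @ [i])} \<rparr>"

definition bethe_subgraph :: "nat \<Rightarrow> nat \<Rightarrow> 'a pair_pre_digraph \<Rightarrow> 'a pair_pre_digraph \<Rightarrow> bool" where
  "bethe_subgraph d K T G \<longleftrightarrow>
     subgraph (with_proj T) (with_proj G) \<and>
     digraph_iso (with_proj T) (with_proj (bethe_tree d K))"

end

theory Submission
  imports Defs "HOL-Analysis.Function_Topology"
begin

text \<open>
  The upper bound on the algebraic connectivity comes from test functions, and the theorem is its
  equality case.  Let \<open>u\<close> and \<open>v\<close> be at distance \<open>2 K\<close> and \<open>\<kappa> = d - 2 sqrt (d - 1) cos \<theta>\<close>.  On the
  Bethe tree with \<open>K\<close> levels, \<open>\<kappa>\<close> is the smallest Dirichlet eigenvalue of the Laplacian, with the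
  positive radial eigenfunction \<open>g j = sin ((K - j) \<theta>) / sqrt (d - 1) ^ j\<close>, which decreases strictly
  (\<open>radial_profile_sin\<close>).  Transplanted to \<open>G\<close> as functions of the distances from \<open>u\<close> and from \<open>v\<close>,
  it yields \<open>f\<close> and \<open>h\<close>, supported on the two balls of radius \<open>K - 1\<close>, which are disjoint and joined
  by no edge.  As \<open>g\<close> decreases, \<open>L f \<le> \<kappa> f\<close> on the ball about \<open>u\<close>, with equality everywhere only if
  the ball is a tree (\<open>lap_radial_le\<close>, \<open>tree_ball_of_lap_eq\<close>); the same holds for \<open>h\<close>.

  Take \<open>a, b > 0\<close> for which \<open>k = a f - b h\<close> is orthogonal to the constants.  Its Rayleigh quotient is
  at most \<open>\<kappa>\<close>, and at least the algebraic connectivity, which is \<open>\<kappa>\<close> by assumption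
  (\<open>algebraic_connectivity_rayleigh\<close>).  So \<open>k\<close> is an eigenfunction (\<open>eigenfunction_of_extremal\<close>), both
  balls are trees, and the eigenvalue equation at the vertices outside the balls, where \<open>k\<close> is zero,
  balances the neighbours in the two trees (\<open>separated_balls_extremal\<close>).  Counting the edges that
  leave the trees shows \<open>a = b\<close>; hence a vertex of the center has at most \<open>d / 2\<close> neighbours in each
  tree, and each tree sends \<open>d (d - 1)^(K - 1)\<close> edges to the center, which gives the bound on its size
  (\<open>card_center_ge\<close>).  The number of vertices follows by adding the sizes of the trees.
\<close>

section \<open>The Laplacian of a regular graph and its Rayleigh quotient\<close>

text \<open>
  The spectral argument only sees the vertex set and the neighbourhoods.  Functions on the vertices
  replace vectors, so that no enumeration of the vertices enters before the characteristic
  polynomial does.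
\<close>

locale regular_nbhd =
  fixes V :: "'a set" and N :: "'a \<Rightarrow> 'a set" and d :: nat
  assumes fin_V: "finite V"
    and nbhd_subset: "x \<in> V \<Longrightarrow> N x \<subseteq> V"
    and nbhd_sym: "x \<in> V \<Longrightarrow> y \<in> N x \<Longrightarrow> x \<in> N y"
    and card_nbhd: "x \<in> V \<Longrightarrow> card (N x) = d"
begin

definition lap :: "('a \<Rightarrow> real) \<Rightarrow> 'a \<Rightarrow> real" where
  "lap f x = (\<Sum>y\<in>N x. f x - f y)"

definition inner :: "('a \<Rightarrow> real) \<Rightarrow> ('a \<Rightarrow> real) \<Rightarrow> real" where
  "inner f g = (\<Sum>x\<in>V. f x * g x)"

lemma finite_nbhd: "x \<in> V \<Longrightarrow> finite (N x)"
  using nbhd_subset fin_V finite_subset by metis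

lemma nbhd_in_V: "x \<in> V \<Longrightarrow> y \<in> N x \<Longrightarrow> y \<in> V"
  using nbhd_subset by blast

lemma sum_arcs_swap: "(\<Sum>x\<in>V. \<Sum>y\<in>N x. F x y) = (\<Sum>x\<in>V. \<Sum>y\<in>N x. F y x)"
proof -
  have e: "N x = {y \<in> V. y \<in> N x}" if "x \<in> V" for x
    using nbhd_subset that by blast
  have "(\<Sum>x\<in>V. \<Sum>y\<in>N x. F x y) = (\<Sum>x\<in>V. \<Sum>y\<in>{y \<in> V. y \<in> N x}. F x y)"
    using e by (intro sum.cong) auto
  also have "\<dots> = (\<Sum>y\<in>V. \<Sum>x\<in>{x \<in> V. y \<in> N x}. F x y)"
    by (rule sum.swap_restrict[OF fin_V fin_V])
  also have "\<dots> = (\<Sum>y\<in>V. \<Sum>x\<in>N y. F x y)"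
  proof (intro sum.cong refl)
    fix y assume "y \<in> V"
    then show "{x \<in> V. y \<in> N x} = N y"
      using nbhd_sym nbhd_in_V by blast
  qed
  finally show ?thesis .
qed

lemma lap_lin: "lap (\<lambda>x. a * f x + b * g x) x = a * lap f x + b * lap g x"
  unfolding lap_def sum_distrib_left sum.distrib[symmetric]
  by (intro sum.cong) (auto simp: algebra_simps)

lemma inner_commute: "inner f g = inner g f"
  by (simp add: inner_def mult.commute)

lemma inner_lin: "inner f (\<lambda>x. a * g x + b * h x) = a * inner f g + b * inner f h"
  unfolding inner_def sum_distrib_left sum.distrib[symmetric]
  by (intro sum.cong) (auto simp: algebra_simps)

lemma lap_eq: "x \<in> V \<Longrightarrow> lap f x = real d * f x - (\<Sum>y\<in>N x. f y)"
  by (simp add: lap_def sum_subtractf card_nbhd)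

lemma lap_self_adjoint: "inner f (lap g) = inner (lap f) g"
proof -
  have "inner f (lap g) = d * inner f g - (\<Sum>x\<in>V. \<Sum>y\<in>N x. f x * g y)"
    unfolding inner_def
    by (simp add: lap_eq right_diff_distrib sum_subtractf sum_distrib_left mult.left_commute[of _ "real d"])
  also have "\<dots> = d * inner f g - (\<Sum>x\<in>V. \<Sum>y\<in>N x. f y * g x)"
    using sum_arcs_swap[of "\<lambda>x y. f x * g y"] by simp
  also have "\<dots> = inner (lap f) g"
    unfolding inner_def
    by (simp add: lap_eq left_diff_distrib sum_subtractf sum_distrib_left sum_distrib_right mult.assoc)
  finally show ?thesis .
qed

lemma lap_quadratic_form: "2 * inner f (lap f) = (\<Sum>x\<in>V. \<Sum>y\<in>N x. (f x - f y)\<^sup>2)"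
proof -
  have 1: "inner f (lap f) = (\<Sum>x\<in>V. \<Sum>y\<in>N x. f x * (f x - f y))"
    by (simp add: inner_def lap_def sum_distrib_left)
  also have "\<dots> = (\<Sum>x\<in>V. \<Sum>y\<in>N x. f y * (f y - f x))"
    by (rule sum_arcs_swap)
  finally have "2 * inner f (lap f) =
      (\<Sum>x\<in>V. \<Sum>y\<in>N x. f x * (f x - f y)) + (\<Sum>x\<in>V. \<Sum>y\<in>N x. f y * (f y - f x))"
    using 1 by simp
  also have "\<dots> = (\<Sum>x\<in>V. \<Sum>y\<in>N x. (f x - f y)\<^sup>2)"
    unfolding sum.distrib[symmetric]
    by (intro sum.cong refl) (simp add: power2_eq_square algebra_simps)
  finally show ?thesis .
qed

lemma sum_lap: "(\<Sum>x\<in>V. lap f x) = 0"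
  using lap_self_adjoint[of "\<lambda>_. 1" f] by (simp add: inner_def lap_def)

text \<open>
  The quadratic form \<open>Q f = \<langle>f, L f\<rangle> - c \<langle>f, f\<rangle>\<close> is nonnegative on the orthogonal complement of the
  constants and vanishes at \<open>h\<close>.  Hence its first variation at \<open>h\<close> vanishes in every direction of
  that complement; the residual \<open>k = L h - c h\<close> is one of these directions because \<open>L\<close> is
  self-adjoint and kills constants, and the variation along it is \<open>2 \<langle>k, k\<rangle>\<close>.  The lemma serves
  twice: for the minimiser of the Rayleigh quotient and for the test function of the two balls.
\<close>

lemma eigenfunction_of_extremal:
  assumes bound: "\<And>k. sum k V = 0 \<Longrightarrow> c * inner k k \<le> inner k (lap k)"
    and h: "sum h V = 0" "inner h (lap h) \<le> c * inner h h"
    and x: "x \<in> V"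
  shows "lap h x = c * h x"
proof -
  define k where "k = (\<lambda>x. 1 * lap h x + (- c) * h x)"
  define Q where "Q = (\<lambda>f. inner f (lap f) - c * inner f f)"
  have sk: "sum k V = 0"
    unfolding k_def using h(1) sum_lap[of h]
    by (simp add: sum_subtractf sum_distrib_left[symmetric])
  have kk: "inner k k = inner k (lap h) - c * inner k h"
    by (subst (2) k_def) (subst inner_lin, simp)
  have Q_nonneg: "0 \<le> 2 * t * inner k k + t\<^sup>2 * Q k" for t
  proof -
    let ?f = "\<lambda>x. 1 * h x + t * k x"
    have "sum ?f V = 0"
      using h(1) sk by (simp add: sum.distrib sum_distrib_left[symmetric])
    from bound[OF this] have "0 \<le> Q ?f" by (simp add: Q_def)
    also have "lap ?f = (\<lambda>x. 1 * lap h x + t * lap k x)"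
      by (rule ext, rule lap_lin)
    then have "Q ?f = inner ?f (\<lambda>x. 1 * lap h x + t * lap k x) - c * inner ?f ?f"
      by (simp only: Q_def)
    also have "\<dots> = Q h + 2 * t * (inner k (lap h) - c * inner k h) + t\<^sup>2 * Q k"
      unfolding inner_lin inner_commute[of ?f] Q_def
      using lap_self_adjoint[of h k] inner_commute[of "lap h" k] inner_commute[of h k]
        inner_commute[of "lap h" h] inner_commute[of "lap k" k] inner_commute[of "lap k" h]
      by (simp add: algebra_simps power2_eq_square)
    also have "\<dots> \<le> 2 * t * inner k k + t\<^sup>2 * Q k"
      using h(2) kk by (simp add: Q_def)
    finally show ?thesis .
  qed
  have kk0: "0 \<le> inner k k" by (simp add: inner_def sum_nonneg)
  have "inner k k = 0"
  proof (rule ccontr)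
    assume "inner k k \<noteq> 0"
    with kk0 have pos: "0 < inner k k" by simp
    \<comment> \<open>Along \<open>t = - \<langle>k, k\<rangle> / s\<close> the linear term outweighs the quadratic one as soon as \<open>s > Q k / 2\<close>.\<close>
    define s where "s = 1 + \<bar>Q k\<bar>"
    have s: "0 < s" "Q k < s" by (auto simp: s_def)
    have "0 \<le> 2 * (- (inner k k / s)) * inner k k + (- (inner k k / s))\<^sup>2 * Q k"
      by (rule Q_nonneg)
    also have "\<dots> = (inner k k)\<^sup>2 / s * (Q k / s - 2)"
      using s by (simp add: field_simps power2_eq_square)
    also have "\<dots> < 0"
      using s pos by (intro mult_pos_neg) (auto simp: field_simps)
    finally show False by simp
  qed
  then have "\<forall>x\<in>V. k x * k x = 0"
    unfolding inner_def by (subst (asm) sum_nonneg_eq_0_iff) (auto simp: fin_V)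
  with x show ?thesis by (simp add: k_def)
qed

text \<open>
  The unit sphere in the complement of the constants is compact: it is a closed subset of the cube
  \<open>[-1, 1]\<close> to the power of the whole type, which is compact in the product topology even when the
  type is infinite.  The minimum over the sphere bounds the Rayleigh quotient by homogeneity.
\<close>

lemma rayleigh_minimizer:
  assumes "2 \<le> card V"
  obtains h \<mu> where "sum h V = 0" "inner h h = 1" "inner h (lap h) = \<mu>"
    "\<And>k. sum k V = 0 \<Longrightarrow> \<mu> * inner k k \<le> inner k (lap k)"
proof -
  define S where "S = PiE UNIV (\<lambda>_::'a. {-1..1::real}) \<inter> {f. sum f V = 0} \<inter> {f. inner f f = 1}"
  have cc: "continuous_on A (\<lambda>f :: 'a \<Rightarrow> real. f x)" for A x
    by (rule continuous_on_subset[OF continuous_on_product_coordinates subset_UNIV])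
  have comp: "compact (PiE UNIV (\<lambda>_::'a. {-1..1::real}))"
  proof -
    have "compactin (product_topology (\<lambda>_::'a. euclidean) UNIV) (PiE UNIV (\<lambda>_::'a. {-1..1::real}))"
      unfolding compactin_PiE by simp
    then show ?thesis
      by (simp only: euclidean_product_topology compactin_euclidean_iff)
  qed
  have "closed {f :: 'a \<Rightarrow> real. sum f V = 0}"
    by (intro closed_Collect_eq continuous_intros cc)
  moreover have "closed {f. inner f f = 1}"
    unfolding inner_def by (intro closed_Collect_eq continuous_intros cc)
  ultimately have S_compact: "compact S"
    unfolding S_def by (intro compact_Int_closed comp)
  have normalize: "(\<lambda>x. if x \<in> V then k x / sqrt (inner k k) else 0) \<in> S"
    (is "?f \<in> S") if "sum k V = 0" "inner k k \<noteq> 0" for k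
  proof -
    have p: "0 < inner k k" using that(2)
      by (simp add: inner_def sum_nonneg order_less_le)
    have "sum ?f V = 0" using that(1)
      by (simp add: sum_divide_distrib[symmetric])
    moreover have 1: "inner ?f ?f = 1"
    proof -
      have "inner ?f ?f = (\<Sum>x\<in>V. (k x * k x) / inner k k)"
        unfolding inner_def[of ?f] using p by (intro sum.cong) auto
      also have "\<dots> = 1" using p
        by (simp add: sum_divide_distrib[symmetric] inner_def[symmetric])
      finally show ?thesis .
    qed
    moreover have "\<bar>?f x\<bar> \<le> 1" for x
    proof (cases "x \<in> V")
      case True
      then have "?f x * ?f x \<le> inner ?f ?f"
        unfolding inner_def by (intro member_le_sum) (auto simp: fin_V)
      then have "(?f x)\<^sup>2 \<le> 1" using 1 by (simp add: power2_eq_square)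
      then show ?thesis using abs_square_le_1 by blast
    qed simp
    ultimately show ?thesis
      unfolding S_def by (auto simp: abs_le_iff minus_le_iff)
  qed
  obtain a b where ab: "a \<in> V" "b \<in> V" "a \<noteq> b"
    using assms by (metis card_2_iff' card_le_Suc_iff insertCI numeral_2_eq_2)
  define k0 where "k0 = (\<lambda>x. (if x = a then 1 else 0) + (if x = b then -1 else (0::real)))"
  have "sum k0 V = 0" using ab by (simp add: k0_def sum.distrib fin_V)
  moreover have "inner k0 k0 \<noteq> 0"
  proof -
    have "k0 a * k0 a \<le> inner k0 k0"
      unfolding inner_def by (intro member_le_sum) (auto simp: fin_V ab)
    then show ?thesis using ab by (simp add: k0_def)
  qed
  ultimately have "S \<noteq> {}" using normalize by blast
  moreover have "continuous_on S (\<lambda>f. inner f (lap f))"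
    unfolding inner_def lap_def by (intro continuous_intros cc)
  ultimately obtain h where h: "h \<in> S" "\<And>f. f \<in> S \<Longrightarrow> inner h (lap h) \<le> inner f (lap f)"
    using continuous_attains_inf[OF S_compact] by blast
  show thesis
  proof (rule that[of h "inner h (lap h)"])
    show "sum h V = 0" "inner h h = 1" using h(1) by (auto simp: S_def)
    fix k :: "'a \<Rightarrow> real" assume k: "sum k V = 0"
    show "inner h (lap h) * inner k k \<le> inner k (lap k)"
    proof (cases "inner k k = 0")
      case True
      have "0 \<le> inner k (lap k)"
        using lap_quadratic_form[of k] by (smt (verit) sum_nonneg zero_le_power2)
      with True show ?thesis by simp
    next
      case False
      let ?f = "\<lambda>x. if x \<in> V then k x / sqrt (inner k k) else 0"
      have p: "0 < inner k k" using False
        by (simp add: inner_def sum_nonneg order_less_le)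
      have "inner h (lap h) \<le> inner ?f (lap ?f)"
        by (intro h(2) normalize k False)
      also have "\<dots> = inner k (lap k) / inner k k"
      proof -
        have l: "lap ?f x = lap k x / sqrt (inner k k)" if "x \<in> V" for x
          unfolding lap_def sum_divide_distrib using nbhd_in_V that
          by (intro sum.cong) (auto simp: diff_divide_distrib)
        have "inner ?f (lap ?f) = (\<Sum>x\<in>V. (k x * lap k x) / inner k k)"
          unfolding inner_def[of ?f] using p by (intro sum.cong) (auto simp: l)
        then show ?thesis by (simp add: sum_divide_distrib[symmetric] inner_def)
      qed
      finally show ?thesis using p by (simp add: field_simps)
    qed
  qed auto
qed

end

section \<open>Radial functions on balls\<close>

text \<open>
  In the \<open>d\<close>-regular tree, functions of the distance \<open>j\<close> from the root that are eigenfunctions of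
  the Laplacian on the ball of radius \<open>K - 1\<close>, with eigenvalue \<open>\<kappa>\<close> and Dirichlet condition at distance
  \<open>K\<close>, are given by this recurrence.  The profile is also required to decrease strictly, which is
  what makes the comparison with an arbitrary regular graph sharp.
\<close>

definition radial_profile :: "nat \<Rightarrow> nat \<Rightarrow> real \<Rightarrow> (nat \<Rightarrow> real) \<Rightarrow> bool" where
  "radial_profile d K \<kappa> g \<longleftrightarrow>
     \<kappa> * g 0 = real d * (g 0 - g 1) \<and>
     (\<forall>j. 0 < j \<and> j < K \<longrightarrow> \<kappa> * g j = real d * g j - g (j - 1) - (real d - 1) * g (Suc j)) \<and>
     (\<forall>j<K. g (Suc j) < g j) \<and> (\<forall>j\<ge>K. g j = 0)"

lemma profile_antimono:
  assumes g: "radial_profile d K \<kappa> g" and "i \<le> j" "j \<le> K"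
  shows "g j \<le> g i"
  using \<open>i \<le> j\<close> \<open>j \<le> K\<close>
proof (induction j rule: dec_induct)
  case (step n)
  then have "g (Suc n) < g n" using g by (simp add: radial_profile_def)
  with step show ?case by simp
qed simp

lemma profile_less:
  assumes g: "radial_profile d K \<kappa> g" and "i \<le> j" "j < K"
  shows "g (Suc j) < g i"
  using profile_antimono[OF g \<open>i \<le> j\<close>] g \<open>j < K\<close>
  by (fastforce simp: radial_profile_def)

lemma profile_pos:
  assumes g: "radial_profile d K \<kappa> g" and "j < K"
  shows "0 < g j"
proof -
  obtain i where i: "K = Suc i" using assms(2) by (cases K) auto
  then have "g (Suc i) < g j" using assms by (intro profile_less) auto
  with g i show ?thesis by (simp add: radial_profile_def)
qed

text \<open>
  These axioms characterise the distance from \<open>r\<close> in a connected graph: by the step axiom no walk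
  is shorter than the level of its end, and the parents trace back a walk of that length.
\<close>

locale level_fun = regular_nbhd V N d for V :: "'a set" and N d +
  fixes r :: 'a and l :: "'a \<Rightarrow> nat"
  assumes root_in_V: "r \<in> V"
    and level_0_iff: "x \<in> V \<Longrightarrow> l x = 0 \<longleftrightarrow> x = r"
    and level_step: "x \<in> V \<Longrightarrow> y \<in> N x \<Longrightarrow> l y \<le> Suc (l x)"
    and level_parent: "x \<in> V \<Longrightarrow> l x = Suc j \<Longrightarrow> \<exists>p\<in>N x. l p = j"
begin

text \<open>
  For \<open>K > 0\<close> this is equivalent to the ball of radius \<open>K - 1\<close> inducing a tree: the conditions
  exclude arcs within a level and a second arc to the previous level.  In this form it is the equality
  case of the comparison of Laplacians.
\<close>

definition tree_ball :: "nat \<Rightarrow> bool" where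
  "tree_ball K \<longleftrightarrow> (\<forall>y\<in>N r. l y = 1) \<and>
     (\<forall>x\<in>V. 0 < l x \<and> l x < K \<longrightarrow>
       (\<exists>p\<in>N x. l p = l x - 1 \<and> (\<forall>y\<in>N x - {p}. l y = Suc (l x))))"

lemma level_step': "x \<in> V \<Longrightarrow> y \<in> N x \<Longrightarrow> l x \<le> Suc (l y)"
  using level_step nbhd_sym nbhd_in_V by blast

text \<open>
  A vertex of level \<open>j > 0\<close> has a neighbour on level \<open>j - 1\<close>, and its remaining neighbours lie on
  level at most \<open>j + 1\<close>; for \<open>j = 0\<close> the latter holds for all neighbours.  Since \<open>g\<close> decreases, the
  Laplacian of \<open>g \<circ> l\<close> is largest when the remaining neighbours lie exactly on level \<open>j + 1\<close>, and then
  it is the Laplacian of the tree.  In this and the next lemma the second claim is the equality case.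
\<close>

lemma lap_radial_root:
  assumes g: "radial_profile d K \<kappa> g" and K: "0 < K"
  shows "lap (\<lambda>x. g (l x)) r \<le> \<kappa> * g 0"
    and "\<kappa> * g 0 \<le> lap (\<lambda>x. g (l x)) r \<Longrightarrow> y \<in> N r \<Longrightarrow> l y = 1"
proof -
  have lr: "l r = 0" using level_0_iff root_in_V by blast
  have le: "g 1 \<le> g (l y)" if "y \<in> N r" for y
    using profile_antimono[OF g] level_step[OF root_in_V that] K lr by simp
  have eq: "lap (\<lambda>x. g (l x)) r = \<kappa> * g 0 - (\<Sum>y\<in>N r. g (l y) - g 1)"
    using g root_in_V card_nbhd
    by (simp add: lap_eq lr radial_profile_def sum_subtractf algebra_simps)
  show "lap (\<lambda>x. g (l x)) r \<le> \<kappa> * g 0"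
    unfolding eq using le by (simp add: sum_nonneg)
  show "l y = 1" if "\<kappa> * g 0 \<le> lap (\<lambda>x. g (l x)) r" "y \<in> N r"
  proof (rule ccontr)
    assume "l y \<noteq> 1"
    then have "l y \<le> 0" using level_step[OF root_in_V that(2)] lr by simp
    then have "g 1 < g (l y)" using profile_less[OF g, of "l y" 0] K by simp
    then have "0 < (\<Sum>y\<in>N r. g (l y) - g 1)"
      using le that(2) finite_nbhd[OF root_in_V] by (intro sum_pos2[of _ y]) auto
    with that(1) eq show False by simp
  qed
qed

lemma lap_radial_inner:
  assumes g: "radial_profile d K \<kappa> g" and x: "x \<in> V" "0 < l x" "l x < K"
    and p: "p \<in> N x" "l p = l x - 1"
  shows "lap (\<lambda>x. g (l x)) x \<le> \<kappa> * g (l x)"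
    and "\<kappa> * g (l x) \<le> lap (\<lambda>x. g (l x)) x \<Longrightarrow> y \<in> N x - {p} \<Longrightarrow> l y = Suc (l x)"
proof -
  have fin: "finite (N x)" using finite_nbhd x by blast
  have "0 < d" using card_nbhd[OF x(1)] p fin by (metis card_gt_0_iff empty_iff)
  have le: "g (Suc (l x)) \<le> g (l y)" if "y \<in> N x" for y
    using profile_antimono[OF g] level_step[OF x(1) that] x by simp
  have "(\<Sum>y\<in>N x. g (l y)) = g (l x - 1) + (\<Sum>y\<in>N x - {p}. g (l y))"
    using p fin by (simp add: sum.remove)
  moreover have "\<kappa> * g (l x) = real d * g (l x) - g (l x - 1) - (real d - 1) * g (Suc (l x))"
    using g x by (simp add: radial_profile_def)
  moreover have "real (card (N x - {p})) * g (Suc (l x)) = (real d - 1) * g (Suc (l x))"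
    using card_nbhd[OF x(1)] p fin \<open>0 < d\<close> by (simp add: of_nat_diff)
  ultimately have eq: "lap (\<lambda>x. g (l x)) x =
      \<kappa> * g (l x) - (\<Sum>y\<in>N x - {p}. g (l y) - g (Suc (l x)))"
    using x by (simp add: lap_eq sum_subtractf algebra_simps)
  show "lap (\<lambda>x. g (l x)) x \<le> \<kappa> * g (l x)"
    unfolding eq using sum_nonneg[of "N x - {p}" "\<lambda>y. g (l y) - g (Suc (l x))"] le by fastforce
  show "l y = Suc (l x)" if "\<kappa> * g (l x) \<le> lap (\<lambda>x. g (l x)) x" "y \<in> N x - {p}"
  proof (rule ccontr)
    assume "l y \<noteq> Suc (l x)"
    then have "l y \<le> l x" using level_step[OF x(1), of y] that(2) by simp
    then have "g (Suc (l x)) < g (l y)" using profile_less[OF g] x by simp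
    then have "0 < (\<Sum>y\<in>N x - {p}. g (l y) - g (Suc (l x)))"
      using le that(2) fin by (intro sum_pos2[of _ y]) auto
    with that(1) eq show False by simp
  qed
qed

lemma lap_radial_le:
  assumes g: "radial_profile d K \<kappa> g" and x: "x \<in> V" "l x < K"
  shows "lap (\<lambda>x. g (l x)) x \<le> \<kappa> * g (l x)"
proof (cases "l x")
  case 0
  then show ?thesis
    using lap_radial_root(1)[OF g] x level_0_iff[OF x(1)] by simp
next
  case (Suc j)
  then obtain p where "p \<in> N x" "l p = l x - 1" using level_parent x by fastforce
  then show ?thesis using lap_radial_inner(1)[OF g x(1) _ x(2)] Suc by simp
qed

lemma tree_ball_of_lap_eq:
  assumes g: "radial_profile d K \<kappa> g" and K: "0 < K"
    and eq: "\<And>x. x \<in> V \<Longrightarrow> l x < K \<Longrightarrow> lap (\<lambda>x. g (l x)) x = \<kappa> * g (l x)"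
  shows "tree_ball K"
  unfolding tree_ball_def
proof (intro conjI ballI impI)
  have lr: "l r = 0" using level_0_iff root_in_V by blast
  fix y assume "y \<in> N r"
  then show "l y = 1" using lap_radial_root(2)[OF g K] eq[OF root_in_V] lr K by simp
next
  fix x assume x: "x \<in> V" "0 < l x \<and> l x < K"
  then obtain p where p: "p \<in> N x" "l p = l x - 1"
    using level_parent[of x "l x - 1"] by (metis Suc_pred')
  have "\<forall>y\<in>N x - {p}. l y = Suc (l x)"
  proof
    fix y assume "y \<in> N x - {p}"
    moreover have "\<kappa> * g (l x) \<le> lap (\<lambda>x. g (l x)) x" using eq x by simp
    ultimately show "l y = Suc (l x)" using lap_radial_inner(2)[OF g x(1) _ _ p] x(2) by blast
  qed
  with p show "\<exists>p\<in>N x. l p = l x - 1 \<and> (\<forall>y\<in>N x - {p}. l y = Suc (l x))" by blast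
qed

lemma lap_radial_outside:
  assumes g: "radial_profile d K \<kappa> g" and x: "x \<in> V" "K < l x"
  shows "lap (\<lambda>x. g (l x)) x = 0"
proof -
  have "g (l y) = 0" if "y \<in> N x" for y
    using level_step'[OF x(1) that] x g by (simp add: radial_profile_def)
  moreover have "g (l x) = 0" using x g by (simp add: radial_profile_def)
  ultimately show ?thesis by (simp add: lap_def)
qed

text \<open>
  At and beyond level \<open>K\<close> the radial function only sees the outermost level of the ball.
\<close>

lemma lap_radial_boundary:
  assumes g: "radial_profile d K \<kappa> g" and x: "x \<in> V" "K \<le> l x"
  shows "lap (\<lambda>x. g (l x)) x = - g (K - 1) * card {y \<in> N x. l y = K - 1}"
proof -
  have "g (l y) = (if l y = K - 1 then g (K - 1) else 0)" if "y \<in> N x" for y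
    using level_step'[OF x(1) that] x g by (auto simp: radial_profile_def)
  then have "(\<Sum>y\<in>N x. g (l y)) = (\<Sum>y\<in>N x. if l y = K - 1 then g (K - 1) else 0)"
    by (rule sum.cong[OF refl])
  also have "\<dots> = (\<Sum>y\<in>{y \<in> N x. l y = K - 1}. g (K - 1))"
    using finite_nbhd[OF x(1)] by (simp add: sum.inter_filter[symmetric])
  finally have "(\<Sum>y\<in>N x. g (l y)) = card {y \<in> N x. l y = K - 1} * g (K - 1)" by simp
  moreover have "g (l x) = 0" using x g by (simp add: radial_profile_def)
  ultimately show ?thesis using x by (simp add: lap_eq)
qed

end

section \<open>Two separated balls\<close>

context regular_nbhd
begin

text \<open>
  Let \<open>f\<close> and \<open>h\<close> be the radial functions of the two balls.  The balls are disjoint and joined by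
  no arc, so a combination \<open>k = a f - b h\<close> satisfies \<open>\<langle>k, L k\<rangle> \<le> \<kappa> \<langle>k, k\<rangle>\<close> by the comparison with the
  tree.  With \<open>a\<close> and \<open>b\<close> chosen to make it orthogonal to the constants, \<open>k\<close> is extremal for the
  spectral gap and thus an eigenfunction.  Reading the eigenvalue equation inside a ball gives
  equality in the comparison, hence a tree; reading it outside both balls, where \<open>k\<close> vanishes, says
  that the contributions of the two outermost levels cancel.
\<close>

lemma separated_balls_extremal:
  assumes u: "level_fun V N d u lu" and v: "level_fun V N d v lv"
    and sep: "\<And>x. x \<in> V \<Longrightarrow> 2 * K \<le> lu x + lv x"
    and g: "radial_profile d K \<kappa> g" and K: "0 < K"
    and bound: "\<And>k. sum k V = 0 \<Longrightarrow> \<kappa> * inner k k \<le> inner k (lap k)"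
  obtains a b where "0 < a" "0 < b"
    "level_fun.tree_ball V N u lu K" "level_fun.tree_ball V N v lv K"
    "\<And>x. x \<in> V \<Longrightarrow> K \<le> lu x \<Longrightarrow> K \<le> lv x \<Longrightarrow>
      a * real (card {y \<in> N x. lu y = K - 1}) = b * real (card {y \<in> N x. lv y = K - 1})"
proof -
  interpret U: level_fun V N d u lu by fact
  interpret W: level_fun V N d v lv by fact
  define f where "f = (\<lambda>x. g (lu x))"
  define h where "h = (\<lambda>x. g (lv x))"
  define a where "a = sum h V"
  define b where "b = sum f V"
  have gnn: "0 \<le> g j" for j
    using profile_pos[OF g] g by (cases "j < K") (auto simp: radial_profile_def less_imp_le)
  have gpos: "0 < g 0" using profile_pos[OF g K] .
  have lr: "lu u = 0" "lv v = 0"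
    using U.level_0_iff U.root_in_V W.level_0_iff W.root_in_V by auto
  have a: "0 < a" unfolding a_def h_def
    using gnn gpos lr W.root_in_V by (intro sum_pos2[of _ v]) (auto simp: fin_V)
  have b: "0 < b" unfolding b_def f_def
    using gnn gpos lr U.root_in_V by (intro sum_pos2[of _ u]) (auto simp: fin_V)
  have f_le: "f x * lap f x \<le> \<kappa> * (f x * f x)" if "x \<in> V" for x
  proof (cases "lu x < K")
    case True
    have "f x * lap f x \<le> f x * (\<kappa> * f x)"
      using U.lap_radial_le[OF g that True] gnn unfolding f_def by (intro mult_left_mono) auto
    then show ?thesis by (simp add: algebra_simps)
  next
    case False then show ?thesis using g by (simp add: f_def radial_profile_def)
  qed
  have h_le: "h x * lap h x \<le> \<kappa> * (h x * h x)" if "x \<in> V" for x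
  proof (cases "lv x < K")
    case True
    have "h x * lap h x \<le> h x * (\<kappa> * h x)"
      using W.lap_radial_le[OF g that True] gnn unfolding h_def by (intro mult_left_mono) auto
    then show ?thesis by (simp add: algebra_simps)
  next
    case False then show ?thesis using g by (simp add: h_def radial_profile_def)
  qed
  \<comment> \<open>A vertex of one ball has level above \<open>K\<close> from the other root, so it and all its neighbours are
    outside the other ball.\<close>
  have far: "h x = 0" "lap h x = 0" if "x \<in> V" "lu x < K" for x
    using W.lap_radial_outside[OF g, of x] sep[of x] that g
    by (auto simp: h_def radial_profile_def)
  have far': "f x = 0" "lap f x = 0" if "x \<in> V" "lv x < K" for x
    using U.lap_radial_outside[OF g, of x] sep[of x] that g
    by (auto simp: f_def radial_profile_def)
  have f0: "f x = 0" if "\<not> lu x < K" for x using that g by (simp add: f_def radial_profile_def)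
  have h0: "h x = 0" if "\<not> lv x < K" for x using that g by (simp add: h_def radial_profile_def)
  define k where "k = (\<lambda>x. a * f x + (- b) * h x)"
  have lapk: "lap k x = a * lap f x - b * lap h x" for x
    unfolding k_def lap_lin by simp
  have k_sum: "sum k V = 0"
    by (simp add: k_def a_def b_def sum_subtractf sum_distrib_left[symmetric])
  have "inner k (lap k) \<le> \<kappa> * inner k k"
    unfolding inner_def sum_distrib_left
  proof (rule sum_mono)
    fix x assume x: "x \<in> V"
    have "k x * lap k x = (a * f x - b * h x) * (a * lap f x - b * lap h x)"
      unfolding lapk by (simp add: k_def)
    also have "\<dots> = a\<^sup>2 * (f x * lap f x) + b\<^sup>2 * (h x * lap h x)"
      using far[OF x] far'[OF x] f0[of x] h0[of x]
      by (cases "lu x < K"; cases "lv x < K") (auto simp: algebra_simps power2_eq_square)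
    also have "\<dots> \<le> a\<^sup>2 * (\<kappa> * (f x * f x)) + b\<^sup>2 * (\<kappa> * (h x * h x))"
      using f_le[OF x] h_le[OF x] by (intro add_mono mult_left_mono) auto
    also have "\<dots> = \<kappa> * (k x * k x)"
      using far[OF x] far'[OF x] f0[of x] h0[of x]
      by (cases "lu x < K"; cases "lv x < K")
        (auto simp: k_def algebra_simps power2_eq_square)
    finally show "k x * lap k x \<le> \<kappa> * (k x * k x)" .
  qed
  then have eig: "lap k x = \<kappa> * k x" if "x \<in> V" for x
    using eigenfunction_of_extremal[OF bound k_sum] that by blast
  show thesis
  proof (rule that[OF a b])
    show "U.tree_ball K"
    proof (rule U.tree_ball_of_lap_eq[OF g K])
      fix x assume x: "x \<in> V" "lu x < K"
      then have "a * lap f x = a * (\<kappa> * f x)"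
        using eig[OF x(1)] far[OF x] unfolding lapk by (simp add: k_def)
      then have "lap f x = \<kappa> * f x" using a by simp
      then show "lap (\<lambda>x. g (lu x)) x = \<kappa> * g (lu x)" by (simp only: f_def)
    qed
    show "W.tree_ball K"
    proof (rule W.tree_ball_of_lap_eq[OF g K])
      fix x assume x: "x \<in> V" "lv x < K"
      then have "b * lap h x = b * (\<kappa> * h x)"
        using eig[OF x(1)] far'[OF x] unfolding lapk by (simp add: k_def)
      then have "lap h x = \<kappa> * h x" using b by simp
      then show "lap (\<lambda>x. g (lv x)) x = \<kappa> * g (lv x)" by (simp only: h_def)
    qed
    fix x assume x: "x \<in> V" "K \<le> lu x" "K \<le> lv x"
    then have "a * lap f x = b * lap h x"
      using eig[OF x(1)] f0[of x] h0[of x] unfolding lapk by (simp add: k_def)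
    then have "g (K - 1) * (a * real (card {y \<in> N x. lu y = K - 1})) =
        g (K - 1) * (b * real (card {y \<in> N x. lv y = K - 1}))"
      using U.lap_radial_boundary[OF g x(1,2)] W.lap_radial_boundary[OF g x(1,3)]
      unfolding f_def h_def by (simp add: mult_ac)
    moreover have "0 < g (K - 1)" using profile_pos[OF g] K by simp
    ultimately show "a * real (card {y \<in> N x. lu y = K - 1}) =
        b * real (card {y \<in> N x. lv y = K - 1})" by simp
  qed
qed

end

section \<open>Tree balls are Bethe trees\<close>

lemma bethe_verts_snoc:
  "xs @ [i] \<in> bethe_verts d K \<longleftrightarrow>
     xs \<in> bethe_verts d K \<and> Suc (length xs) < K \<and> i < (if xs = [] then d else d - 1)"
  unfolding bethe_verts_def by (auto simp: nth_append less_Suc_eq)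

context level_fun
begin

definition level :: "nat \<Rightarrow> 'a set" where
  "level j = {x \<in> V. l x = j}"

definition children :: "'a \<Rightarrow> 'a set" where
  "children x = {y \<in> N x. l y = Suc (l x)}"

lemma level_root: "l r = 0"
  using level_0_iff root_in_V by blast

lemma level_0_eq: "level 0 = {r}"
  unfolding level_def using level_0_iff root_in_V by auto

lemma finite_level: "finite (level j)"
  by (simp add: level_def fin_V)

text \<open>
  Double counting of the arcs between consecutive levels.
\<close>

lemma arcs_between_levels:
  "(\<Sum>x\<in>level j. card (children x)) = (\<Sum>y\<in>level (Suc j). card {x \<in> N y. l x = j})"
proof -
  have 1: "children x = {y \<in> level (Suc j). y \<in> N x}" if "x \<in> level j" for x
    using that nbhd_in_V by (auto simp: children_def level_def)
  have 2: "{x \<in> level j. y \<in> N x} = {x \<in> N y. l x = j}" if "y \<in> level (Suc j)" for y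
    using that nbhd_in_V nbhd_sym unfolding level_def by blast
  have "(\<Sum>x\<in>level j. card (children x)) = (\<Sum>x\<in>level j. \<Sum>y\<in>{y \<in> level (Suc j). y \<in> N x}. 1)"
    by (intro sum.cong) (auto simp: 1)
  also have "\<dots> = (\<Sum>y\<in>level (Suc j). \<Sum>x\<in>{x \<in> level j. y \<in> N x}. 1)"
    by (rule sum.swap_restrict[OF finite_level finite_level])
  also have "\<dots> = (\<Sum>y\<in>level (Suc j). card {x \<in> N y. l x = j})"
    by (intro sum.cong) (auto simp: 2)
  finally show ?thesis .
qed

context
  fixes K :: nat
  assumes tree: "tree_ball K" and K_pos: "0 < K" and d_pos: "0 < d"
begin

lemma parent_obtain:
  assumes "x \<in> V" "0 < l x" "l x < K"
  obtains p where "p \<in> N x" "{p. p \<in> N x \<and> l p = l x - 1} = {p}" "children x = N x - {p}"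
proof -
  obtain p where p: "p \<in> N x" "l p = l x - 1" "\<forall>y\<in>N x - {p}. l y = Suc (l x)"
    using tree assms unfolding tree_ball_def by blast
  have "{p. p \<in> N x \<and> l p = l x - 1} = {p}"
  proof (intro equalityI subsetI)
    fix q assume q: "q \<in> {p. p \<in> N x \<and> l p = l x - 1}"
    show "q \<in> {p}"
    proof (rule ccontr)
      assume "q \<notin> {p}"
      with q p(3) have "l q = Suc (l x)" "l q = l x - 1" by auto
      then show False by simp
    qed
  qed (use p in auto)
  moreover have "children x = N x - {p}"
    using p unfolding children_def by auto
  ultimately show thesis using that p(1) by blast
qed

lemma card_parents:
  assumes "x \<in> V" "l x = Suc j" "Suc j < K"
  shows "card {p \<in> N x. l p = j} = 1"
  using assms by (auto elim!: parent_obtain[of x])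

lemma adjacent_level:
  assumes "x \<in> V" "l x < K" "y \<in> N x"
  shows "l y = Suc (l x) \<or> l x = Suc (l y)"
proof (cases "l x = 0")
  case True
  then have "x = r" using level_0_iff assms by blast
  then show ?thesis using tree assms level_root by (simp add: tree_ball_def)
next
  case False
  then obtain p where "{p. p \<in> N x \<and> l p = l x - 1} = {p}" "children x = N x - {p}"
    using assms by (auto elim: parent_obtain[of x])
  then show ?thesis using assms False unfolding children_def by (cases "y = p") auto
qed

lemma card_children:
  assumes "x \<in> V" "l x < K"
  shows "card (children x) = (if l x = 0 then d else d - 1)"
proof (cases "l x = 0")
  case True
  then have "x = r" using level_0_iff assms by blast
  moreover have "children r = N r"
    using tree level_root by (auto simp: children_def tree_ball_def)
  ultimately show ?thesis using card_nbhd assms level_root by simp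
next
  case False
  then obtain p where "p \<in> N x" "children x = N x - {p}"
    using assms by (auto elim: parent_obtain[of x])
  then show ?thesis using card_nbhd[OF assms(1)] finite_nbhd[OF assms(1)] False by simp
qed

lemma card_level_Suc_eq:
  assumes "Suc j < K"
  shows "card (level (Suc j)) = (\<Sum>x\<in>level j. card (children x))"
  using assms card_parents by (simp add: arcs_between_levels) (simp add: level_def)

lemma arcs_from_level:
  assumes "j < K"
  shows "(\<Sum>x\<in>level j. card (children x)) = d * (d - 1) ^ j"
  using assms
proof (induction j)
  case 0
  then show ?case
    using card_children[OF root_in_V] level_root by (simp add: level_0_eq)
next
  case (Suc j)
  have "card (level (Suc j)) = d * (d - 1) ^ j"
    using Suc card_level_Suc_eq[of j] by simp
  moreover have "(\<Sum>x\<in>level (Suc j). card (children x)) = (\<Sum>x\<in>level (Suc j). d - 1)"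
    using Suc.prems card_children by (intro sum.cong) (auto simp: level_def)
  ultimately show ?case by simp
qed

lemma card_level_Suc:
  assumes "Suc j < K"
  shows "card (level (Suc j)) = d * (d - 1) ^ j"
  using card_level_Suc_eq arcs_from_level[of j] assms by simp

lemma card_tree_ball:
  "card {x \<in> V. l x < K} = 1 + d * (\<Sum>j<K - 1. (d - 1) ^ j)"
proof -
  have "card {x \<in> V. l x < n} = (\<Sum>j<n. card (level j))" for n
  proof (induction n)
    case (Suc n)
    have "{x \<in> V. l x < Suc n} = {x \<in> V. l x < n} \<union> level n"
      by (auto simp: level_def)
    then show ?case using Suc
      by (simp add: card_Un_disjoint fin_V finite_level level_def disjoint_iff)
  qed simp
  then have "card {x \<in> V. l x < K} = (\<Sum>j<Suc (K - 1). card (level j))"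
    using K_pos by simp
  also have "\<dots> = 1 + (\<Sum>j<K - 1. card (level (Suc j)))"
    by (simp only: sum.lessThan_Suc_shift level_0_eq) simp
  also have "(\<Sum>j<K - 1. card (level (Suc j))) = (\<Sum>j<K - 1. d * (d - 1) ^ j)"
    by (intro sum.cong) (auto simp: card_level_Suc)
  finally show ?thesis by (simp add: sum_distrib_left)
qed

text \<open>
  Any numbering of the children of each vertex identifies a tree ball with the Bethe tree: a list of
  child indices is read as a path from the root.
\<close>

definition child :: "'a \<Rightarrow> nat \<Rightarrow> 'a" where
  "child x = (SOME h. bij_betw h {0..<card (children x)} (children x))"

definition vertex_at :: "nat list \<Rightarrow> 'a" where
  "vertex_at xs = foldl child r xs"

lemma child_bij:
  assumes "x \<in> V"
  shows "bij_betw (child x) {0..<card (children x)} (children x)"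
  unfolding child_def
  by (rule someI_ex[OF ex_bij_betw_nat_finite]) (simp add: children_def finite_nbhd[OF assms])

lemma vertex_at_simps:
  "vertex_at [] = r" "vertex_at (xs @ [i]) = child (vertex_at xs) i"
  by (simp_all add: vertex_at_def)

lemma vertex_at_level:
  "xs \<in> bethe_verts d K \<Longrightarrow> vertex_at xs \<in> V \<and> l (vertex_at xs) = length xs"
proof (induction xs rule: rev_induct)
  case Nil
  then show ?case by (simp add: vertex_at_simps root_in_V level_root)
next
  case (snoc i xs)
  then have IH: "vertex_at xs \<in> V" "l (vertex_at xs) = length xs"
    and i: "Suc (length xs) < K" "i < (if xs = [] then d else d - 1)"
    by (auto simp: bethe_verts_snoc)
  have "i < card (children (vertex_at xs))"
    using card_children[OF IH(1)] IH(2) i by (auto split: if_splits)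
  then have "child (vertex_at xs) i \<in> children (vertex_at xs)"
    using child_bij[OF IH(1)] by (auto simp: bij_betw_def)
  then show ?case using IH nbhd_in_V by (auto simp: vertex_at_simps children_def)
qed

lemma vertex_at_children:
  assumes xs: "xs \<in> bethe_verts d K" and len: "Suc (length xs) < K"
  shows "bij_betw (\<lambda>i. vertex_at (xs @ [i])) {i. xs @ [i] \<in> bethe_verts d K} (children (vertex_at xs))"
proof -
  have "{i. xs @ [i] \<in> bethe_verts d K} = {0..<card (children (vertex_at xs))}"
    using card_children[of "vertex_at xs"] vertex_at_level[OF xs] xs len
    by (auto simp: bethe_verts_snoc)
  then show ?thesis
    using child_bij vertex_at_level[OF xs] by (simp add: vertex_at_simps)
qed

lemma vertex_at_snoc_child:
  assumes "xs @ [i] \<in> bethe_verts d K"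
  shows "vertex_at (xs @ [i]) \<in> children (vertex_at xs)"
  using vertex_at_children[of xs] assms
  by (auto simp: bij_betw_def bethe_verts_snoc)

text \<open>
  Two lists with the same end vertex have the same length, their initial parts lead to the unique
  neighbour of that vertex on the previous level, and the last indices agree because the children
  are numbered injectively.
\<close>

lemma vertex_at_inj:
  "xs \<in> bethe_verts d K \<Longrightarrow> ys \<in> bethe_verts d K \<Longrightarrow> vertex_at xs = vertex_at ys \<Longrightarrow> xs = ys"
proof (induction xs arbitrary: ys rule: rev_induct)
  case Nil
  then show ?case using vertex_at_level by (metis length_0_conv)
next
  case (snoc i xs)
  let ?z = "vertex_at (xs @ [i])"
  have "length ys = length (xs @ [i])" using snoc.prems vertex_at_level by metis
  then obtain zs k where ys: "ys = zs @ [k]" "length zs = length xs"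
    by (cases ys rule: rev_cases) auto
  have b: "xs \<in> bethe_verts d K" "zs \<in> bethe_verts d K" "Suc (length xs) < K"
    using snoc.prems unfolding ys by (auto simp: bethe_verts_snoc)
  have z: "?z \<in> children (vertex_at xs)" "?z \<in> children (vertex_at zs)"
    using vertex_at_snoc_child snoc.prems unfolding ys(1) by (blast, metis)
  have l: "?z \<in> V" "l ?z = Suc (length xs)"
    using vertex_at_level[OF snoc.prems(1)] by simp_all
  have "vertex_at xs \<in> {p \<in> N ?z. l p = length xs}" "vertex_at zs \<in> {p \<in> N ?z. l p = length xs}"
    using z b ys vertex_at_level nbhd_sym unfolding children_def by auto
  moreover have "card {p \<in> N ?z. l p = length xs} = 1"
    using card_parents l b by simp
  ultimately have "vertex_at xs = vertex_at zs"
    by (metis card_1_singletonE singletonD)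
  then have eq: "xs = zs" using snoc.IH b by blast
  have "inj_on (\<lambda>i. vertex_at (xs @ [i])) {i. xs @ [i] \<in> bethe_verts d K}"
    using vertex_at_children b by (blast dest: bij_betw_imp_inj_on)
  then have "i = k" using snoc.prems ys eq by (auto dest: inj_onD)
  then show ?case using ys eq by simp
qed

lemma vertex_at_surj:
  "x \<in> V \<Longrightarrow> l x < K \<Longrightarrow> \<exists>xs\<in>bethe_verts d K. vertex_at xs = x"
proof (induction "l x" arbitrary: x)
  case 0
  then have "vertex_at [] = x" using level_0_iff by (simp add: vertex_at_simps)
  moreover have "[] \<in> bethe_verts d K" using K_pos by (simp add: bethe_verts_def)
  ultimately show ?case by blast
next
  case (Suc n)
  then obtain p where p: "p \<in> N x" "l p = n" using level_parent[of x n] by auto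
  then obtain xs where xs: "xs \<in> bethe_verts d K" "vertex_at xs = p"
    using Suc nbhd_in_V by (metis Suc_lessD)
  then have "x \<in> children (vertex_at xs)"
    using p Suc nbhd_sym by (auto simp: children_def)
  moreover have "Suc (length xs) < K" using vertex_at_level xs p Suc by force
  ultimately have "x \<in> (\<lambda>i. vertex_at (xs @ [i])) ` {i. xs @ [i] \<in> bethe_verts d K}"
    using vertex_at_children[OF xs(1)] by (simp add: bij_betw_def)
  then show ?case by blast
qed

lemma vertex_at_bij: "bij_betw vertex_at (bethe_verts d K) {x \<in> V. l x < K}"
  unfolding bij_betw_def
proof
  show "inj_on vertex_at (bethe_verts d K)" using vertex_at_inj by (blast intro: inj_onI)
  have "vertex_at xs \<in> {x \<in> V. l x < K}" if "xs \<in> bethe_verts d K" for xs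
    using vertex_at_level[OF that] that by (simp add: bethe_verts_def)
  then show "vertex_at ` bethe_verts d K = {x \<in> V. l x < K}"
    using vertex_at_surj by blast
qed

lemma vertex_at_child_iff:
  assumes xs: "xs \<in> bethe_verts d K" and ys: "ys \<in> bethe_verts d K"
  shows "vertex_at ys \<in> children (vertex_at xs) \<longleftrightarrow> (\<exists>i. ys = xs @ [i])"
proof
  assume *: "vertex_at ys \<in> children (vertex_at xs)"
  then have "length ys = Suc (length xs)"
    using vertex_at_level xs ys by (auto simp: children_def)
  then have "Suc (length xs) < K" using ys by (simp add: bethe_verts_def)
  from vertex_at_children[OF xs this] * obtain i
    where "xs @ [i] \<in> bethe_verts d K" "vertex_at ys = vertex_at (xs @ [i])"
    by (auto simp: bij_betw_def)
  then show "\<exists>i. ys = xs @ [i]" using vertex_at_inj ys by blast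
next
  assume "\<exists>i. ys = xs @ [i]"
  then obtain i where i: "ys = xs @ [i]" by blast
  show "vertex_at ys \<in> children (vertex_at xs)"
    using vertex_at_snoc_child i ys by blast
qed

lemma vertex_at_adjacent_iff:
  assumes xs: "xs \<in> bethe_verts d K" and ys: "ys \<in> bethe_verts d K"
  shows "vertex_at ys \<in> N (vertex_at xs) \<longleftrightarrow> (\<exists>i. ys = xs @ [i] \<or> xs = ys @ [i])"
proof -
  have "vertex_at xs \<in> V" "l (vertex_at xs) < K" "vertex_at ys \<in> V"
    using vertex_at_level xs ys by (auto simp: bethe_verts_def)
  then have "vertex_at ys \<in> N (vertex_at xs) \<longleftrightarrow>
      vertex_at ys \<in> children (vertex_at xs) \<or> vertex_at xs \<in> children (vertex_at ys)"
    using adjacent_level nbhd_sym unfolding children_def by blast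
  then show ?thesis using vertex_at_child_iff xs ys by auto
qed

end

end

section \<open>The size of the center\<close>

context regular_nbhd
begin

text \<open>
  Each tree sends \<open>d (d - 1)^(K - 1)\<close> arcs into the set \<open>C\<close> of vertices outside both balls.
  Summing the balance equation over \<open>C\<close> therefore gives \<open>a = b\<close>, so every vertex of \<open>C\<close> has
  as many neighbours in one tree as in the other, that is, at most \<open>d / 2\<close> in each.
\<close>

lemma card_center_ge:
  assumes u: "level_fun V N d u lu" and v: "level_fun V N d v lv"
    and sep: "\<And>x. x \<in> V \<Longrightarrow> 2 * K \<le> lu x + lv x"
    and K: "0 < K" and d: "2 \<le> d"
    and tree: "level_fun.tree_ball V N u lu K" "level_fun.tree_ball V N v lv K"
    and ab: "0 < a" "0 < b"
    and balance: "\<And>x. x \<in> V \<Longrightarrow> K \<le> lu x \<Longrightarrow> K \<le> lv x \<Longrightarrow>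
      a * real (card {y \<in> N x. lu y = K - 1}) = b * real (card {y \<in> N x. lv y = K - 1})"
  shows "2 * (d - 1) ^ (K - 1) \<le> card {x \<in> V. K \<le> lu x \<and> K \<le> lv x}"
proof -
  define C where "C = {x \<in> V. K \<le> lu x \<and> K \<le> lv x}"
  have *: "(\<Sum>x\<in>C. card {y \<in> N x. lw y = K - 1}) = d * (d - 1) ^ (K - 1)"
    if "level_fun V N d w lw" "level_fun.tree_ball V N w lw K"
      "level_fun.level V lw K \<subseteq> C" "\<And>x. x \<in> C \<Longrightarrow> K \<le> lw x" for w lw
  proof -
    interpret W: level_fun V N d w lw by fact
    have empty: "{y \<in> N x. lw y = K - 1} = {}" if x: "x \<in> C - W.level K" for x
    proof -
      have "x \<in> V" "K < lw x"
        using x \<open>\<And>x. x \<in> C \<Longrightarrow> K \<le> lw x\<close>[of x] by (auto simp: C_def W.level_def)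
      then show ?thesis using W.level_step' K by fastforce
    qed
    have "(\<Sum>x\<in>C. card {y \<in> N x. lw y = K - 1}) =
        (\<Sum>x\<in>W.level K. card {y \<in> N x. lw y = K - 1})"
    proof (rule sum.mono_neutral_right)
      show "\<forall>x\<in>C - W.level K. card {y \<in> N x. lw y = K - 1} = 0"
        using empty by (metis card.empty)
    qed (use that(3) in \<open>auto simp: C_def fin_V\<close>)
    also have "\<dots> = d * (d - 1) ^ (K - 1)"
      using W.arcs_between_levels[of "K - 1"] W.arcs_from_level[OF that(2) K, of "K - 1"] K d
      by simp
    finally show ?thesis .
  qed
  have Eu: "(\<Sum>x\<in>C. card {y \<in> N x. lu y = K - 1}) = d * (d - 1) ^ (K - 1)" (is "?u = ?E")
    using sep by (intro *[OF u tree(1)]) (force simp: C_def level_fun.level_def[OF u])+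
  have Ev: "(\<Sum>x\<in>C. card {y \<in> N x. lv y = K - 1}) = d * (d - 1) ^ (K - 1)"
    using sep by (intro *[OF v tree(2)]) (force simp: C_def level_fun.level_def[OF v])+
  have "a * real (\<Sum>x\<in>C. card {y \<in> N x. lu y = K - 1}) =
      b * real (\<Sum>x\<in>C. card {y \<in> N x. lv y = K - 1})"
    unfolding of_nat_sum sum_distrib_left
    by (intro sum.cong refl balance) (auto simp: C_def)
  then have "a = b" using d unfolding Eu Ev by simp
  have half: "2 * card {y \<in> N x. lu y = K - 1} \<le> d" if "x \<in> C" for x
  proof -
    have x: "x \<in> V" using that by (simp add: C_def)
    have "a * real (card {y \<in> N x. lu y = K - 1}) = b * real (card {y \<in> N x. lv y = K - 1})"
      using balance that by (simp add: C_def)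
    then have "card {y \<in> N x. lu y = K - 1} = card {y \<in> N x. lv y = K - 1}"
      using ab \<open>a = b\<close> by simp
    then have "2 * card {y \<in> N x. lu y = K - 1} =
        card {y \<in> N x. lu y = K - 1} + card {y \<in> N x. lv y = K - 1}" by simp
    also have "\<dots> = card ({y \<in> N x. lu y = K - 1} \<union> {y \<in> N x. lv y = K - 1})"
    proof (rule card_Un_disjoint[symmetric])
      show "{y \<in> N x. lu y = K - 1} \<inter> {y \<in> N x. lv y = K - 1} = {}"
        using sep nbhd_in_V[OF x] K by fastforce
    qed (use finite_nbhd[OF x] in auto)
    also have "\<dots> \<le> card (N x)"
      using finite_nbhd[OF x] by (intro card_mono) auto
    finally show ?thesis using card_nbhd[OF x] by simp
  qed
  have "2 * ?E = (\<Sum>x\<in>C. 2 * card {y \<in> N x. lu y = K - 1})"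
    unfolding Eu[symmetric] sum_distrib_left ..
  also have "\<dots> \<le> (\<Sum>x\<in>C. d)" by (intro sum_mono half)
  finally have "d * (2 * (d - 1) ^ (K - 1)) \<le> d * card C" by (simp add: mult_ac)
  then show ?thesis using d by (simp add: C_def)
qed

end

section \<open>The radial eigenfunction of the Bethe tree\<close>

text \<open>
  For \<open>K \<ge> 2\<close> the product form of the equation changes sign between \<open>pi / (2 K)\<close> and \<open>pi / K\<close>.  Strictly
  between these points neither tangent has a pole, so the tangent form has a root there and the
  smallest one is below \<open>pi / K\<close>.  For \<open>K = 1\<close> the convention \<open>tan (pi / 2) = 0\<close> makes \<open>pi / 2\<close> the
  smallest root, and the product form holds there because \<open>cos\<close> vanishes.
\<close>

lemma smallest_pos_tan_root_bounds:
  assumes d: "3 \<le> d" and K: "1 \<le> K" and root: "smallest_pos_tan_root d K \<theta>"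
  shows "0 < \<theta>" "real K * \<theta> < pi"
    "(real d - 2) * (sin (real K * \<theta>) * cos \<theta>) + real d * (cos (real K * \<theta>) * sin \<theta>) = 0"
proof -
  show pos: "0 < \<theta>" using root by (simp add: smallest_pos_tan_root_def)
  have tr: "tan (\<theta> * real K) = - (real d / (real d - 2)) * tan \<theta>"
    and least: "\<And>\<phi>. 0 < \<phi> \<Longrightarrow> tan_root d K \<phi> \<Longrightarrow> \<theta> \<le> \<phi>"
    using root by (auto simp: smallest_pos_tan_root_def tan_root_def)
  have "real K * \<theta> < pi \<and>
    (real d - 2) * (sin (real K * \<theta>) * cos \<theta>) + real d * (cos (real K * \<theta>) * sin \<theta>) = 0"
  proof (cases "K = 1")
    case True
    have "tan_root d K (pi / 2)" by (simp add: tan_root_def True tan_def)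
    then have le: "\<theta> \<le> pi / 2" by (intro least) simp_all
    have "(1 + real d / (real d - 2)) * tan \<theta> = 0" using tr True by (simp add: algebra_simps)
    moreover have "1 + real d / (real d - 2) > 0" using d by (simp add: add_pos_pos)
    ultimately have "tan \<theta> = 0" by simp
    moreover have "0 < sin \<theta>" using pos le by (intro sin_gt_zero) auto
    ultimately have "cos \<theta> = 0" by (auto simp: tan_def)
    moreover have "\<theta> < pi" using le pi_gt_zero by linarith
    ultimately show ?thesis using True by simp
  next
    case False
    then have K2: "2 \<le> K" using K by simp
    define F where "F = (\<lambda>t. (real d - 2) * (sin (real K * t) * cos t) + real d * (cos (real K * t) * sin t))"
    define a where "a = pi / (2 * real K)"
    define b where "b = pi / real K"
    have ab: "0 < a" "a < b" "b \<le> pi / 2" "real K * a = pi / 2" "real K * b = pi"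
      using K2 by (auto simp: a_def b_def field_simps)
    have "0 < F a"
    proof -
      have "0 < cos a" using ab by (intro cos_gt_zero) auto
      then show ?thesis using d unfolding F_def ab(4) by simp
    qed
    moreover have "F b < 0"
    proof -
      have "0 < sin b" using ab by (intro sin_gt_zero) auto
      then show ?thesis using d unfolding F_def ab(5) by simp
    qed
    moreover have "continuous_on {a..b} F" unfolding F_def by (intro continuous_intros)
    ultimately obtain t where t: "a \<le> t" "t \<le> b" "F t = 0"
      using IVT2'[of F b 0 a] ab by force
    then have t': "a < t" "t < b" using \<open>0 < F a\<close> \<open>F b < 0\<close> by (auto simp: order_less_le)
    have Kt: "pi / 2 < real K * t" "real K * t < pi"
      using t' ab K2 by (metis mult_less_cancel_left_pos of_nat_0_less_iff less_le_trans zero_less_numeral)+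
    have c: "0 < cos t" using t' ab by (intro cos_gt_zero) auto
    have cK: "cos (real K * t) < 0"
      using cos_monotone_0_pi[of "pi / 2" "real K * t"] Kt by simp
    have "tan_root d K t"
      using t(3) c cK d unfolding tan_root_def F_def tan_def
      by (simp add: field_simps)
    then have "\<theta> \<le> t" using least t' ab by simp
    then have lt: "\<theta> < b" using t' by simp
    then have Kth: "real K * \<theta> < pi" using ab K2
      by (metis mult_less_cancel_left_pos of_nat_0_less_iff less_le_trans zero_less_numeral)
    have c0: "0 < cos \<theta>" using pos lt ab by (intro cos_gt_zero) auto
    have tpos: "0 < tan \<theta>" using pos lt ab by (intro tan_gt_zero) auto
    \<comment> \<open>A nonzero value excludes a pole, where the convention makes the tangent zero.\<close>
    have "tan (\<theta> * real K) < 0"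
      unfolding tr using tpos d by simp
    then have "cos (real K * \<theta>) \<noteq> 0" by (auto simp: tan_def mult.commute)
    then have "F \<theta> = 0"
      using tr c0 d unfolding F_def tan_def by (simp add: field_simps)
    with Kth show ?thesis by (simp add: F_def)
  qed
  then show "real K * \<theta> < pi"
    "(real d - 2) * (sin (real K * \<theta>) * cos \<theta>) + real d * (cos (real K * \<theta>) * sin \<theta>) = 0"
    by blast+
qed

text \<open>
  The substitution \<open>g j = H j / sqrt (d - 1) ^ j\<close> turns the recurrence into
  \<open>H (j - 1) + H (j + 1) = 2 cos \<theta> * H j\<close>, whose solution vanishing at \<open>K\<close> is \<open>H j = sin ((K - j) \<theta>)\<close>;
  the equation at the root of the tree is the equation for \<open>\<theta>\<close>.  For \<open>j > K\<close> the truncated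
  subtraction extends \<open>g\<close> by zero.  Monotonicity follows from positivity of \<open>g\<close> and of the eigenvalue,
  since the recurrence reads
  \<open>(d - 1) (g j - g (j + 1)) = \<kappa> * g j + (g (j - 1) - g j)\<close>.
\<close>

lemma radial_profile_sin:
  assumes d: "3 \<le> d" and K: "1 \<le> K" and root: "smallest_pos_tan_root d K \<theta>"
  shows "radial_profile d K (real d - 2 * sqrt (real d - 1) * cos \<theta>)
    (\<lambda>j. sin (real (K - j) * \<theta>) / sqrt (real d - 1) ^ j)"
proof -
  note B = smallest_pos_tan_root_bounds[OF assms]
  define s where "s = sqrt (real d - 1)"
  define \<kappa> where "\<kappa> = real d - 2 * s * cos \<theta>"
  define g where "g = (\<lambda>j. sin (real (K - j) * \<theta>) / s ^ j)"
  have s2: "s * s = real d - 1" using d by (simp add: s_def)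
  have s: "0 < s" using d by (simp add: s_def)
  have g_pos: "0 < g j" if "j < K" for j
  proof -
    have "real (K - j) * \<theta> \<le> real K * \<theta>" using B(1) by (intro mult_right_mono) auto
    then have "real (K - j) * \<theta> < pi" using B(2) by linarith
    then have "0 < sin (real (K - j) * \<theta>)" using that B(1) by (intro sin_gt_zero) auto
    then show ?thesis using s by (simp add: g_def)
  qed
  have g_zero: "g j = 0" if "K \<le> j" for j using that by (simp add: g_def)
  have kpos: "0 < \<kappa>"
  proof -
    have "\<theta> < pi"
    proof -
      have "1 * \<theta> \<le> real K * \<theta>" using K B(1) by (intro mult_right_mono) auto
      then show ?thesis using B(2) by simp
    qed
    then have "cos \<theta> < 1" using cos_monotone_0_pi[of 0 \<theta>] B(1) by simp
    then have "2 * s * cos \<theta> < 2 * s * 1" using s by (intro mult_strict_left_mono) auto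
    also have "\<dots> \<le> real d"
      using s2 zero_le_square[of "s - 1"] by (simp add: algebra_simps)
    finally show ?thesis by (simp add: \<kappa>_def)
  qed
  have root_eq: "\<kappa> * g 0 = real d * (g 0 - g 1)"
  proof -
    have e: "sin (real (K - 1) * \<theta>) = sin (real K * \<theta>) * cos \<theta> - cos (real K * \<theta>) * sin \<theta>"
      using K by (simp add: of_nat_diff left_diff_distrib sin_diff)
    have "real d * sin (real (K - 1) * \<theta>) = 2 * (s * s) * (sin (real K * \<theta>) * cos \<theta>)"
      using B(3) unfolding s2 e by (simp add: algebra_simps)
    then have "real d * g 1 = 2 * s * cos \<theta> * g 0"
      using s by (simp add: g_def field_simps)
    then show ?thesis by (simp add: \<kappa>_def algebra_simps)
  qed
  have rec: "\<kappa> * g j = real d * g j - g (j - 1) - (real d - 1) * g (Suc j)" if "0 < j" "j < K" for j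
  proof -
    have "real (K - (j - 1)) = real (K - j) + 1" "real (K - Suc j) = real (K - j) - 1"
      using that by (auto simp: of_nat_diff)
    moreover have "sin ((m + 1) * \<theta>) + sin ((m - 1) * \<theta>) = 2 * sin (m * \<theta>) * cos \<theta>" for m
      by (simp add: distrib_right left_diff_distrib sin_add sin_diff)
    ultimately have *: "sin (real (K - (j - 1)) * \<theta>) + sin (real (K - Suc j) * \<theta>) =
        2 * sin (real (K - j) * \<theta>) * cos \<theta>"
      by (simp only:)
    from \<open>0 < j\<close> obtain i where i: "j = Suc i" by (cases j) auto
    have "g (j - 1) + (real d - 1) * g (Suc j) =
        s * (sin (real (K - (j - 1)) * \<theta>) + sin (real (K - Suc j) * \<theta>)) / s ^ j"
      unfolding s2[symmetric] using s by (simp add: g_def i field_simps)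
    also have "\<dots> = 2 * s * cos \<theta> * g j"
      unfolding * by (simp add: g_def)
    finally show ?thesis by (simp add: \<kappa>_def algebra_simps)
  qed
  have dec: "g (Suc j) < g j" if "j < K" for j
    using that
  proof (induction j)
    case 0
    then have "0 < \<kappa> * g 0" using kpos g_pos by simp
    then have "0 < real d * (g 0 - g 1)" by (simp only: root_eq)
    then show ?case using d by (simp add: zero_less_mult_iff)
  next
    case (Suc j)
    then have "0 < \<kappa> * g (Suc j) + (g j - g (Suc j))"
      using kpos g_pos[of "Suc j"] by (simp add: add_pos_pos)
    also have "\<dots> = (real d - 1) * (g (Suc j) - g (Suc (Suc j)))"
      using rec[of "Suc j"] Suc.prems by (simp add: algebra_simps)
    finally show ?case using d by (simp add: zero_less_mult_iff)
  qed
  have "radial_profile d K \<kappa> g"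
    unfolding radial_profile_def using root_eq rec dec g_zero by blast
  then show ?thesis by (simp add: \<kappa>_def g_def s_def)
qed

section \<open>The spectral gap of a connected graph\<close>

context level_fun
begin

lemma locally_constant_imp_constant:
  assumes "\<And>x y. x \<in> V \<Longrightarrow> y \<in> N x \<Longrightarrow> f x = f y" and "x \<in> V"
  shows "f x = f r"
  using assms(2)
proof (induction "l x" arbitrary: x)
  case 0
  then show ?case using level_0_iff by metis
next
  case (Suc n)
  then obtain p where p: "p \<in> N x" "l p = n" using level_parent[of x n] by auto
  then show ?case using Suc assms(1)[of x p] nbhd_in_V by metis
qed

text \<open>
  In a connected graph the minimum of the Rayleigh quotient over the complement of the constants is
  positive, since a function of zero energy is constant.
\<close>

lemma spectral_gap_eigenfunction:
  assumes "2 \<le> card V"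
  obtains h \<mu> where "0 < \<mu>" "inner h h = 1" "\<And>x. x \<in> V \<Longrightarrow> lap h x = \<mu> * h x"
    "\<And>k. sum k V = 0 \<Longrightarrow> \<mu> * inner k k \<le> inner k (lap k)"
proof -
  obtain h \<mu> where h: "sum h V = 0" "inner h h = 1" "inner h (lap h) = \<mu>"
    and bound: "\<And>k. sum k V = 0 \<Longrightarrow> \<mu> * inner k k \<le> inner k (lap k)"
    using rayleigh_minimizer[OF assms] by metis
  have \<mu>: "2 * \<mu> = (\<Sum>x\<in>V. \<Sum>y\<in>N x. (h x - h y)\<^sup>2)"
    using lap_quadratic_form[of h] h(3) by simp
  have "\<mu> \<noteq> 0"
  proof
    assume "\<mu> = 0"
    then have z: "\<forall>x\<in>V. (\<Sum>y\<in>N x. (h x - h y)\<^sup>2) = 0"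
      using \<mu> sum_nonneg_eq_0_iff[OF fin_V, of "\<lambda>x. \<Sum>y\<in>N x. (h x - h y)\<^sup>2"]
      by (simp add: sum_nonneg)
    have "h x = h y" if "x \<in> V" "y \<in> N x" for x y
    proof -
      have "\<forall>y\<in>N x. (h x - h y)\<^sup>2 = 0"
        using z that(1)
          sum_nonneg_eq_0_iff[OF finite_nbhd[OF that(1)], of "\<lambda>y. (h x - h y)\<^sup>2"] by simp
      then show ?thesis using that(2) by simp
    qed
    then have const: "h x = h r" if "x \<in> V" for x
      using locally_constant_imp_constant that by blast
    then have "sum h V = card V * h r" by simp
    then have "h r = 0" using h(1) assms by simp
    then have "inner h h = 0" using const by (simp add: inner_def)
    then show False using h(2) by simp
  qed
  moreover have "0 \<le> \<mu>" using \<mu> by (smt (verit) sum_nonneg zero_le_power2)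
  moreover have "lap h x = \<mu> * h x" if "x \<in> V" for x
    using eigenfunction_of_extremal[OF bound h(1) _ that] h by simp
  ultimately show thesis using that[of \<mu> h] h(2) bound by simp
qed

end

section \<open>Distances in graphs\<close>

definition nbhd :: "'a pair_pre_digraph \<Rightarrow> 'a \<Rightarrow> 'a set" where
  "nbhd G x = {y. (x, y) \<in> parcs G}"

definition bfs_level :: "'a pair_pre_digraph \<Rightarrow> 'a \<Rightarrow> 'a \<Rightarrow> nat" where
  "bfs_level G u x = (LEAST n. (u, x) \<in> parcs G ^^ n)"

lemma pair_graph_sym:
  assumes "pair_graph G" "(x, y) \<in> parcs G"
  shows "(y, x) \<in> parcs G"
proof -
  interpret pair_graph G by fact
  show ?thesis using pair_sym_arcs assms(2) by (simp add: symmetric_def sym_def)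
qed

lemma out_degree_eq_card_nbhd: "out_degree (with_proj G) x = card (nbhd G x)"
proof -
  have "out_arcs (with_proj G) x = Pair x ` nbhd G x"
    by (auto simp: out_arcs_def nbhd_def)
  then show ?thesis by (simp add: out_degree_def card_image inj_on_def)
qed

lemma regular_nbhd_graph:
  assumes "pair_graph G" "regular_graph d G"
  shows "regular_nbhd (pverts G) (nbhd G) d"
proof -
  interpret pair_graph G by fact
  show ?thesis
  proof
    show "finite (pverts G)" by (rule pair_finite_verts)
    show "nbhd G x \<subseteq> pverts G" for x using in_arcsD2 by (auto simp: nbhd_def)
    show "x \<in> nbhd G y" if "y \<in> nbhd G x" for x y
      using pair_graph_sym[OF assms(1)] that by (simp add: nbhd_def)
    show "card (nbhd G x) = d" if "x \<in> pverts G" for x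
      using assms(2) that by (simp add: regular_graph_def out_degree_eq_card_nbhd)
  qed
qed

lemma connected_relpow:
  assumes "pair_graph G" "Digraph_Component.connected (with_proj G)"
    and "u \<in> pverts G" "x \<in> pverts G"
  shows "\<exists>n. (u, x) \<in> parcs G ^^ n"
proof -
  interpret pair_graph G by fact
  have "strongly_connected (with_proj G)"
    using symmetric_connected_imp_strongly_connected[OF pair_sym_arcs] assms(2) by simp
  then have "u \<rightarrow>\<^sup>*\<^bsub>with_proj G\<^esub> x"
    using assms(3,4) by (simp add: strongly_connected_def)
  then have "(u, x) \<in> (parcs G)\<^sup>*"
    unfolding reachable_def by (simp add: rtrancl_on_rtranclI)
  then show ?thesis by (simp add: rtrancl_power)
qed

lemma bfs_level_relpow:
  assumes "pair_graph G" "Digraph_Component.connected (with_proj G)"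
    and "u \<in> pverts G" "x \<in> pverts G"
  shows "(u, x) \<in> parcs G ^^ bfs_level G u x"
  unfolding bfs_level_def using connected_relpow[OF assms] by (rule LeastI_ex)

lemma bfs_level_le: "(u, x) \<in> parcs G ^^ n \<Longrightarrow> bfs_level G u x \<le> n"
  unfolding bfs_level_def by (rule Least_le)

lemma level_fun_bfs:
  assumes G: "pair_graph G" "Digraph_Component.connected (with_proj G)" "regular_graph d G"
    and u: "u \<in> pverts G"
  shows "level_fun (pverts G) (nbhd G) d u (bfs_level G u)"
proof -
  interpret regular_nbhd "pverts G" "nbhd G" d by (rule regular_nbhd_graph) fact+
  note path = bfs_level_relpow[OF G(1,2) u]
  have step: "bfs_level G u y \<le> Suc (bfs_level G u x)" if "x \<in> pverts G" "y \<in> nbhd G x" for x y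
    using path[OF that(1)] that(2) by (intro bfs_level_le relpow_Suc_I) (auto simp: nbhd_def)
  show ?thesis
  proof
    show "u \<in> pverts G" by fact
    show "bfs_level G u x = 0 \<longleftrightarrow> x = u" if "x \<in> pverts G" for x
      using path[OF that] bfs_level_le[where n = 0 and x = u and u = u and G = G] by auto
    show "bfs_level G u y \<le> Suc (bfs_level G u x)" if "x \<in> pverts G" "y \<in> nbhd G x" for x y
      using step that .
    show "\<exists>p\<in>nbhd G x. bfs_level G u p = j" if x: "x \<in> pverts G" "bfs_level G u x = Suc j" for x j
    proof -
      obtain p where p: "(u, p) \<in> parcs G ^^ j" "(p, x) \<in> parcs G"
        using path[OF x(1)] x(2) by auto
      then have px: "p \<in> nbhd G x" using pair_graph_sym[OF G(1)] by (simp add: nbhd_def)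
      have "bfs_level G u p \<le> j" by (rule bfs_level_le[OF p(1)])
      moreover have "bfs_level G u x \<le> Suc (bfs_level G u p)"
        using step[of p x] nbhd_in_V[OF x(1) px] p(2) by (simp add: nbhd_def)
      ultimately show ?thesis using px x(2) by auto
    qed
  qed
qed

lemma graph_dist_le_relpow:
  assumes G: "pair_graph G" and "(u, v) \<in> parcs G ^^ n" "v \<in> pverts G"
  shows "graph_dist G u v \<le> ereal (real n)"
proof -
  interpret pair_graph G by fact
  have "\<exists>p. awalk u p v \<and> length p = n" using assms(2)
  proof (induction n arbitrary: u)
    case 0
    then show ?case using assms(3) by (auto intro!: exI[of _ "[]"] simp: awalk_Nil_iff)
  next
    case (Suc n)
    from Suc.prems obtain z where z: "(u, z) \<in> parcs G" "(z, v) \<in> parcs G ^^ n"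
      by (rule relpow_Suc_E2)
    from Suc.IH[OF z(2)] obtain p where "awalk z p v" "length p = n" by blast
    then show ?case using z(1) by (intro exI[of _ "(u, z) # p"]) (simp add: awalk_Cons_iff)
  qed
  then obtain p where p: "awalk u p v" "length p = n" by blast
  have "graph_dist G u v \<le> awalk_cost (\<lambda>_. 1) p"
    unfolding graph_dist_def by (rule min_cost_le_walk_cost[OF p(1)])
  then show ?thesis using p(2) by (simp add: awalk_cost_def sum_list_triv)
qed

lemma relpow_sym:
  assumes "sym R" "(x, y) \<in> R ^^ n"
  shows "(y, x) \<in> R ^^ n"
  using assms(2)
proof (induction n arbitrary: y)
  case (Suc n)
  then obtain z where "(x, z) \<in> R ^^ n" "(z, y) \<in> R" by auto
  then show ?case using Suc.IH assms(1) by (meson relpow_Suc_I2 symD)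
qed simp

text \<open>
  For two vertices at distance greater than \<open>n\<close> this is the triangle inequality.
\<close>

lemma bfs_levels_separated:
  assumes G: "pair_graph G" "Digraph_Component.connected (with_proj G)"
    and D: "graph_diameter G = ereal (real (Suc n))"
  obtains u v where "u \<in> pverts G" "v \<in> pverts G"
    "\<And>x. x \<in> pverts G \<Longrightarrow> Suc n \<le> bfs_level G u x + bfs_level G v x"
proof -
  have "ereal (real n) < graph_diameter G" by (simp add: D)
  then obtain u v where uv: "u \<in> pverts G" "v \<in> pverts G" "ereal (real n) < graph_dist G u v"
    unfolding graph_diameter_def by (auto simp: less_SUP_iff)
  have sym: "sym (parcs G)" using pair_graph_sym[OF G(1)] by (blast intro: symI)
  have "Suc n \<le> bfs_level G u x + bfs_level G v x" if x: "x \<in> pverts G" for x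
  proof -
    have "(x, v) \<in> parcs G ^^ bfs_level G v x"
      using relpow_sym[OF sym bfs_level_relpow[OF G uv(2) x]] .
    then have "(u, v) \<in> parcs G ^^ (bfs_level G u x + bfs_level G v x)"
      unfolding relpow_add using bfs_level_relpow[OF G uv(1) x] by blast
    from uv(3) graph_dist_le_relpow[OF G(1) this uv(2)]
    have "ereal (real n) < ereal (real (bfs_level G u x + bfs_level G v x))" by (rule less_le_trans)
    then show ?thesis by simp
  qed
  with uv that show thesis by blast
qed

section \<open>Algebraic connectivity\<close>

lemma sorted_nth_1_le:
  fixes xs :: "'a :: linorder list"
  assumes "sorted xs" "x \<in> set xs" "y \<in> set xs" "x < y"
  shows "xs ! 1 \<le> y"
proof -
  obtain i j where ij: "i < length xs" "xs ! i = x" "j < length xs" "xs ! j = y"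
    using assms(2,3) by (auto simp: in_set_conv_nth)
  have "j \<noteq> 0"
  proof
    assume "j = 0"
    with ij sorted_nth_mono[OF assms(1), of j i] assms(4) show False by auto
  qed
  then show ?thesis using sorted_nth_mono[OF assms(1), of 1 j] ij by simp
qed

text \<open>
  The values of an eigenfunction along the enumeration of the vertices form an eigenvector of the
  Laplacian matrix.
\<close>

lemma laplacian_spectrum_eigenvalue:
  assumes G: "pair_graph G" "regular_graph d G"
    and f: "\<And>x. x \<in> pverts G \<Longrightarrow> regular_nbhd.lap (nbhd G) f x = c * f x"
    and z: "z \<in> pverts G" "f z \<noteq> 0"
  shows "c \<in># laplacian_spectrum G"
proof -
  interpret pair_graph G by fact
  interpret regular_nbhd "pverts G" "nbhd G" d by (rule regular_nbhd_graph) fact+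
  define vs where "vs = (SOME vs. distinct vs \<and> set vs = pverts G)"
  define n where "n = length vs"
  define A where "A = laplacian_mat G vs"
  define w where "w = vec n (\<lambda>i. f (vs ! i))"
  have vs: "distinct vs" "set vs = pverts G"
    using someI_ex[OF finite_distinct_list[OF pair_finite_verts]] unfolding vs_def
    by (simp_all add: conj_commute)
  have A: "A \<in> carrier_mat n n" by (simp add: A_def laplacian_mat_def n_def)
  have bij: "bij_betw ((!) vs) {..<n} (pverts G)"
    using bij_betw_nth[OF vs(1)] vs(2) n_def by blast
  have "A *\<^sub>v w = c \<cdot>\<^sub>v w"
  proof (rule eq_vecI)
    fix i assume "i < dim_vec (c \<cdot>\<^sub>v w)"
    then have i: "i < n" by (simp add: w_def)
    define x where "x = vs ! i"
    have x: "x \<in> pverts G" unfolding x_def vs(2)[symmetric] using i n_def by (intro nth_mem) simp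
    have xx: "x \<notin> nbhd G x" using pair_no_loops by (force simp: nbhd_def)
    define H where "H = (\<lambda>y. (if y = x then real d * f x else 0) + (if y \<in> nbhd G x then - f y else 0))"
    have "(A *\<^sub>v w) $ i = (\<Sum>j<n. A $$ (i, j) * f (vs ! j))"
      using i A by (auto simp: scalar_prod_def w_def lessThan_atLeast0 intro!: sum.cong)
    also have "\<dots> = (\<Sum>j<n. H (vs ! j))"
    proof (intro sum.cong refl)
      fix j assume "j \<in> {..<n}"
      then have j: "j < n" by simp
      have "vs ! j = x \<longleftrightarrow> i = j"
        using i j vs(1) by (auto simp: x_def n_def nth_eq_iff_index_eq)
      then show "A $$ (i, j) * f (vs ! j) = H (vs ! j)"
        using i j x xx G(2) unfolding A_def laplacian_mat_def H_def n_def x_def[symmetric]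
        by (auto simp: regular_graph_def nbhd_def x_def)
    qed
    also have "\<dots> = (\<Sum>y\<in>pverts G. H y)"
      by (rule sum.reindex_bij_betw[OF bij])
    also have "\<dots> = real d * f x - (\<Sum>y\<in>nbhd G x. f y)"
    proof -
      have "(\<Sum>y\<in>pverts G. if y \<in> nbhd G x then - f y else 0) = (\<Sum>y\<in>pverts G \<inter> nbhd G x. - f y)"
        by (simp add: sum.inter_restrict fin_V)
      also have "pverts G \<inter> nbhd G x = nbhd G x" using nbhd_subset[OF x] by blast
      finally show ?thesis using x by (simp add: H_def sum.distrib fin_V sum_negf)
    qed
    also have "\<dots> = c * f x" using f[OF x] lap_eq[OF x] by simp
    finally show "(A *\<^sub>v w) $ i = (c \<cdot>\<^sub>v w) $ i" using i by (simp add: w_def x_def)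
  qed (use A in \<open>simp add: w_def\<close>)
  moreover have "w \<noteq> 0\<^sub>v n"
  proof -
    obtain i where "i < n" "vs ! i = z" using z vs(2) by (metis in_set_conv_nth n_def)
    then have "w $ i \<noteq> 0\<^sub>v n $ i" using z(2) by (simp add: w_def)
    then show ?thesis by metis
  qed
  moreover have "w \<in> carrier_vec n" by (simp add: w_def)
  ultimately have "eigenvalue A c"
    unfolding eigenvalue_def eigenvector_def using A by auto
  then have "poly (char_poly A) c = 0" using eigenvalue_root_char_poly[OF A] by simp
  moreover have "char_poly A \<noteq> 0" using degree_monic_char_poly[OF A] by auto
  ultimately show ?thesis
    unfolding laplacian_spectrum_def vs_def[symmetric] A_def[symmetric] by simp
qed

lemma algebraic_connectivity_le:
  assumes G: "pair_graph G" "regular_graph d G"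
    and f: "\<And>x. x \<in> pverts G \<Longrightarrow> regular_nbhd.lap (nbhd G) f x = c * f x"
    and z: "z \<in> pverts G" "f z \<noteq> 0" and c: "0 < c"
  shows "algebraic_connectivity G \<le> c"
proof -
  interpret regular_nbhd "pverts G" "nbhd G" d by (rule regular_nbhd_graph) fact+
  have "c \<in># laplacian_spectrum G" by (rule laplacian_spectrum_eigenvalue) fact+
  moreover have "0 \<in># laplacian_spectrum G"
    by (rule laplacian_spectrum_eigenvalue[OF G, of "\<lambda>_. 1" _ z]) (use z in \<open>auto simp: lap_def\<close>)
  ultimately show ?thesis
    unfolding algebraic_connectivity_def using c
    by (intro sorted_nth_1_le[of _ 0]) auto
qed

text \<open>
  Only this half of the variational principle enters, and it avoids the spectral theorem: the minimum
  \<open>\<mu>\<close> of the Rayleigh quotient is a positive eigenvalue and \<open>0\<close> is another eigenvalue, so the second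
  smallest root of the characteristic polynomial is at most \<open>\<mu>\<close>.
\<close>

lemma algebraic_connectivity_rayleigh:
  assumes G: "pair_graph G" "Digraph_Component.connected (with_proj G)" "regular_graph d G"
    and card: "2 \<le> card (pverts G)" and k: "sum k (pverts G) = 0"
  shows "algebraic_connectivity G * regular_nbhd.inner (pverts G) k k \<le>
    regular_nbhd.inner (pverts G) k (regular_nbhd.lap (nbhd G) k)"
proof -
  obtain u where u: "u \<in> pverts G" using card by (metis card.empty ex_in_conv not_numeral_le_zero)
  interpret level_fun "pverts G" "nbhd G" d u "bfs_level G u" by (rule level_fun_bfs) fact+
  obtain h \<mu> where h: "0 < \<mu>" "inner h h = 1" "\<And>x. x \<in> pverts G \<Longrightarrow> lap h x = \<mu> * h x"
    and bound: "\<And>k. sum k (pverts G) = 0 \<Longrightarrow> \<mu> * inner k k \<le> inner k (lap k)"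
    using spectral_gap_eigenfunction[OF card] by metis
  have "\<exists>z\<in>pverts G. h z \<noteq> 0"
  proof (rule ccontr)
    assume "\<not> ?thesis"
    then have "inner h h = 0" by (simp add: inner_def)
    with h(2) show False by simp
  qed
  then obtain z where "z \<in> pverts G" "h z \<noteq> 0" by blast
  then have "algebraic_connectivity G \<le> \<mu>"
    using algebraic_connectivity_le[OF G(1,3) h(3)] h(1) by blast
  then have "algebraic_connectivity G * inner k k \<le> \<mu> * inner k k"
    by (intro mult_right_mono) (auto simp: inner_def sum_nonneg)
  also have "\<dots> \<le> inner k (lap k)" by (rule bound[OF k])
  finally show ?thesis .
qed

section \<open>Bethe subgraphs\<close>

lemma digraph_iso_with_projI:
  assumes wf: "wf_digraph (with_proj S)"
    and bij: "bij_betw f (pverts S) (pverts T)"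
    and arcs: "\<And>x y. (x, y) \<in> parcs T \<Longrightarrow> x \<in> pverts T \<and> y \<in> pverts T"
    and adj: "\<And>x y. x \<in> pverts S \<Longrightarrow> y \<in> pverts S \<Longrightarrow> (f x, f y) \<in> parcs T \<longleftrightarrow> (x, y) \<in> parcs S"
  shows "digraph_iso (with_proj S) (with_proj T)"
proof -
  interpret wf_digraph "with_proj S" by fact
  have end_in: "x \<in> pverts S" "y \<in> pverts S" if "(x, y) \<in> parcs S" for x y
    using tail_in_verts[of "(x, y)"] head_in_verts[of "(x, y)"] that by auto
  define hom where "hom = \<lparr>iso_verts = f, iso_arcs = map_prod f f, iso_head = snd, iso_tail = fst\<rparr>"
  have inj: "inj_on f (pverts S)" and img: "f ` pverts S = pverts T"
    using bij by (auto simp: bij_betw_def)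
  have "digraph_isomorphism hom"
    unfolding digraph_isomorphism_def
    using wf inj end_in by (auto simp: hom_def inj_on_def)
  moreover have "with_proj T = app_iso hom (with_proj S)"
  proof -
    have "parcs T = map_prod f f ` parcs S"
    proof (intro equalityI subsetI)
      fix e assume "e \<in> parcs T"
      moreover obtain a b where e: "e = (a, b)" by (cases e)
      ultimately have "a \<in> f ` pverts S" "b \<in> f ` pverts S" using arcs[of a b] img by auto
      then obtain x y where xy: "x \<in> pverts S" "y \<in> pverts S" "a = f x" "b = f y"
        by (elim imageE) auto
      with adj[of x y] \<open>e \<in> parcs T\<close> e have "(x, y) \<in> parcs S" by simp
      with xy e show "e \<in> map_prod f f ` parcs S" by (intro image_eqI[of _ _ "(x, y)"]) auto
    qed (use adj end_in in auto)
    then show ?thesis by (simp add: app_iso_def hom_def with_proj_def img)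
  qed
  ultimately show ?thesis unfolding digraph_iso_def by blast
qed

lemma bethe_subgraph_ball:
  assumes G: "pair_graph G" and L: "level_fun (pverts G) (nbhd G) d u l"
    and tree: "level_fun.tree_ball (pverts G) (nbhd G) u l K" and K: "0 < K" and d: "0 < d"
  defines "B \<equiv> {x \<in> pverts G. l x < K}"
  shows "bethe_subgraph d K \<lparr>pverts = B, parcs = {(x, y) \<in> parcs G. x \<in> B \<and> y \<in> B}\<rparr> G"
    (is "bethe_subgraph d K ?T G")
proof -
  interpret pair_graph G by fact
  interpret level_fun "pverts G" "nbhd G" d u l by fact
  have wfT: "wf_digraph (with_proj ?T)" by unfold_locales auto
  have bij: "bij_betw vertex_at (bethe_verts d K) B"
    unfolding B_def by (rule vertex_at_bij[OF tree K d])
  have "digraph_iso (with_proj ?T) (with_proj (bethe_tree d K))"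
  proof (rule digraph_iso_with_projI[OF wfT, of "the_inv_into (bethe_verts d K) vertex_at"])
    show "bij_betw (the_inv_into (bethe_verts d K) vertex_at) (pverts ?T) (pverts (bethe_tree d K))"
      using bij_betw_the_inv_into[OF bij] by (simp add: bethe_tree_def)
    show "x \<in> pverts (bethe_tree d K) \<and> y \<in> pverts (bethe_tree d K)"
      if "(x, y) \<in> parcs (bethe_tree d K)" for x y
      using that by (simp add: bethe_tree_def)
    fix x y assume "x \<in> pverts ?T" "y \<in> pverts ?T"
    then have "x \<in> B" "y \<in> B" by simp_all
    then obtain xs ys where xs: "xs \<in> bethe_verts d K" "x = vertex_at xs"
      and ys: "ys \<in> bethe_verts d K" "y = vertex_at ys"
      using bij by (auto simp: bij_betw_def)
    have inv: "the_inv_into (bethe_verts d K) vertex_at (vertex_at zs) = zs"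
      if "zs \<in> bethe_verts d K" for zs
      using bij that by (simp add: bij_betw_def the_inv_into_f_f)
    show "(the_inv_into (bethe_verts d K) vertex_at x, the_inv_into (bethe_verts d K) vertex_at y)
        \<in> parcs (bethe_tree d K) \<longleftrightarrow> (x, y) \<in> parcs ?T"
      using vertex_at_adjacent_iff[OF tree K d xs(1) ys(1)] \<open>x \<in> B\<close> \<open>y \<in> B\<close> xs ys
      by (simp add: inv bethe_tree_def nbhd_def)
  qed
  moreover have "subgraph (with_proj ?T) (with_proj G)"
    using wfT wf_digraph_axioms unfolding subgraph_def compatible_def by (auto simp: B_def)
  ultimately show ?thesis by (simp add: bethe_subgraph_def)
qed

section \<open>Diameter-maximal graphs\<close>

lemma bethe_order_formula:
  fixes q :: real
  assumes "q \<noteq> 1"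
  shows "2 * (1 + (q + 1) * (\<Sum>j<n. q ^ j)) + 2 * q ^ n = 4 * ((q ^ Suc n - 1) / (q - 1))"
  using assms by (simp add: geometric_sum field_simps)

theorem theoremI5:
  fixes G :: "'a pair_pre_digraph" and d K :: nat
  assumes "d \<ge> 3" and "K \<ge> 1"
    and "pair_graph G" and "Digraph_Component.connected (with_proj G)"
    and "regular_graph d G"
    and "graph_diameter G = ereal (real (2 * K))"
    and "diameter_maximal d K G"
  shows "(\<exists>T1 T2 :: 'a pair_pre_digraph.
            bethe_subgraph d K T1 G \<and> bethe_subgraph d K T2 G \<and>
            pverts T1 \<inter> pverts T2 = {} \<and>
            card (pverts G - (pverts T1 \<union> pverts T2)) \<ge> 2 * (d - 1) ^ (K - 1)) \<and>
         real (card (pverts G)) \<ge>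
           2 * (1 + real d * (\<Sum>j<K - 1. (real d - 1) ^ j)) + 2 * (real d - 1) ^ (K - 1) \<and>
         2 * (1 + real d * (\<Sum>j<K - 1. (real d - 1) ^ j)) + 2 * (real d - 1) ^ (K - 1) =
           4 * (((real d - 1) ^ K - 1) / (real d - 2))"
proof -
  note d = assms(1) and K = assms(2) and G = assms(3,4,5)
  define V where "V = pverts G"
  obtain \<theta> where root: "smallest_pos_tan_root d K \<theta>"
    and AC: "algebraic_connectivity G = real d - 2 * sqrt (real d - 1) * cos \<theta>"
    using assms(7) by (auto simp: diameter_maximal_def)
  obtain u v where uv: "u \<in> V" "v \<in> V"
    and sep: "\<And>x. x \<in> V \<Longrightarrow> 2 * K \<le> bfs_level G u x + bfs_level G v x"
    unfolding V_def using bfs_levels_separated[OF G(1,2), of "2 * K - 1"] assms(2,6) by auto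
  define lu where "lu = bfs_level G u"
  define lv where "lv = bfs_level G v"
  have U: "level_fun V (nbhd G) d u lu" and W: "level_fun V (nbhd G) d v lv"
    using level_fun_bfs[OF G] uv by (auto simp: V_def lu_def lv_def)
  interpret U: level_fun V "nbhd G" d u lu by fact
  interpret W: level_fun V "nbhd G" d v lv by fact
  have sep: "2 * K \<le> lu x + lv x" if "x \<in> V" for x
    using sep[OF that] by (simp add: lu_def lv_def)
  have "u \<noteq> v" using sep[OF uv(1)] U.level_root W.level_root K by auto
  then have card2: "2 \<le> card V"
    using uv U.fin_V card_mono[of V "{u, v}"] by simp
  have bound: "algebraic_connectivity G * U.inner k k \<le> U.inner k (U.lap k)" if "sum k V = 0" for k
    using algebraic_connectivity_rayleigh[OF G] card2 that unfolding V_def by blast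
  \<comment> \<open>By maximality the eigenvalue of the tree profile is the algebraic connectivity, a lower
    bound for the Rayleigh quotients of functions orthogonal to the constants.\<close>
  have profile: "radial_profile d K (algebraic_connectivity G)
      (\<lambda>j. sin (real (K - j) * \<theta>) / sqrt (real d - 1) ^ j)"
    unfolding AC by (rule radial_profile_sin[OF d K root])
  have K0: "0 < K" and d0: "0 < d" and d2: "2 \<le> d" using K d by auto
  obtain a b where ab: "0 < a" "0 < b"
    and trees: "U.tree_ball K" "W.tree_ball K"
    and balance: "\<And>x. x \<in> V \<Longrightarrow> K \<le> lu x \<Longrightarrow> K \<le> lv x \<Longrightarrow>
      a * real (card {y \<in> nbhd G x. lu y = K - 1}) = b * real (card {y \<in> nbhd G x. lv y = K - 1})"
    using U.separated_balls_extremal[OF U W sep profile K0 bound] by blast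
  define Bu where "Bu = {x \<in> V. lu x < K}"
  define Bv where "Bv = {x \<in> V. lv x < K}"
  define C where "C = {x \<in> V. K \<le> lu x \<and> K \<le> lv x}"
  have center: "2 * (d - 1) ^ (K - 1) \<le> card C"
    unfolding C_def by (rule U.card_center_ge[OF U W sep K0 d2 trees ab balance])
  have Bu: "bethe_subgraph d K \<lparr>pverts = Bu, parcs = {(x, y) \<in> parcs G. x \<in> Bu \<and> y \<in> Bu}\<rparr> G"
    unfolding Bu_def V_def
    by (rule bethe_subgraph_ball[OF G(1) U[unfolded V_def] trees(1)[unfolded V_def] K0 d0])
  have Bv: "bethe_subgraph d K \<lparr>pverts = Bv, parcs = {(x, y) \<in> parcs G. x \<in> Bv \<and> y \<in> Bv}\<rparr> G"
    unfolding Bv_def V_def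
    by (rule bethe_subgraph_ball[OF G(1) W[unfolded V_def] trees(2)[unfolded V_def] K0 d0])
  have disj: "Bu \<inter> Bv = {}" using sep by (force simp: Bu_def Bv_def)
  have C: "pverts G - (Bu \<union> Bv) = C" by (auto simp: V_def C_def Bu_def Bv_def)
  have "card V = card Bu + card Bv + card C"
  proof -
    have "V = (Bu \<union> Bv) \<union> C" by (auto simp: C_def Bu_def Bv_def)
    moreover have "(Bu \<union> Bv) \<inter> C = {}" by (auto simp: C_def Bu_def Bv_def)
    moreover have "finite Bu" "finite Bv" "finite C" by (auto simp: C_def Bu_def Bv_def U.fin_V)
    ultimately show ?thesis using disj by (simp add: card_Un_disjoint)
  qed
  then have "2 * (1 + d * (\<Sum>j<K - 1. (d - 1) ^ j)) + 2 * (d - 1) ^ (K - 1) \<le> card V"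
    using center U.card_tree_ball[OF trees(1) K0 d0] W.card_tree_ball[OF trees(2) K0 d0]
    by (simp add: Bu_def Bv_def)
  then have "real (2 * (1 + d * (\<Sum>j<K - 1. (d - 1) ^ j)) + 2 * (d - 1) ^ (K - 1)) \<le> real (card V)"
    by (rule of_nat_mono)
  then have total: "2 * (1 + real d * (\<Sum>j<K - 1. (real d - 1) ^ j)) + 2 * (real d - 1) ^ (K - 1)
      \<le> real (card (pverts G))"
    using d by (simp add: V_def of_nat_diff)
  have formula: "2 * (1 + real d * (\<Sum>j<K - 1. (real d - 1) ^ j)) + 2 * (real d - 1) ^ (K - 1) =
      4 * (((real d - 1) ^ K - 1) / (real d - 2))"
    using bethe_order_formula[of "real d - 1" "K - 1"] d K by simp
  from Bu Bv disj center total formula show ?thesis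
    by (intro conjI exI[of _ "\<lparr>pverts = Bu, parcs = {(x, y) \<in> parcs G. x \<in> Bu \<and> y \<in> Bu}\<rparr>"]
        exI[of _ "\<lparr>pverts = Bv, parcs = {(x, y) \<in> parcs G. x \<in> Bv \<and> y \<in> Bv}\<rparr>"]) (simp_all add: C)
qed

end
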